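(* Let $\Delta_u(d,n)$ denote the maximum diameter of the graph of a $d$-dimensional polyhedron with $n$ facets. For $d \geq 3$ and $n \geq 2^{d-1}$, \[ \Delta_u(d,n) \leq \frac1{16}\,\frac{n^3}{\sqrt{3\log n-5}}. \]
   Context: A polyhedron is the intersection of finitely many closed halfspaces; $d$ is the dimension of its affine span and $n$ the number of its facets. The diameter is the maximum over pairs of vertices of the edge-distance in the graph (1-skeleton). All logarithms are base $2$. *)

theory Defs
  imports "HOL-Analysis.Analysis" "HOL-Library.Extended_Nat" "HOL-Library.Extended_Real"
begin

definition vertices :: "'a::euclidean_space set \<Rightarrow> 'a set" where
  "vertices P = {v. v extreme_point_of P}"

text \<open>
  Unbounded one-dimensional faces do not contribute to the graph: an edge of the graph is a
  one-dimensional face that is the segment joining two vertices.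
\<close>

definition graph_edges :: "'a::euclidean_space set \<Rightarrow> ('a \<times> 'a) set" where
  "graph_edges P = {(u, v). u \<in> vertices P \<and> v \<in> vertices P \<and> closed_segment u v edge_of P}"

text \<open>
  Least number of edges of a walk from \<open>u\<close> to \<open>v\<close>; it is \<open>\<infinity>\<close> if there is none,
  because the infimum of the empty set is \<open>\<infinity>\<close> in \<open>enat\<close>.
\<close>

definition edge_distance :: "'a::euclidean_space set \<Rightarrow> 'a \<Rightarrow> 'a \<Rightarrow> enat" where
  "edge_distance P u v = (INF k \<in> {k. (u, v) \<in> graph_edges P ^^ k}. enat k)"

text \<open>A polyhedron without vertices gets diameter 0.\<close>

definition graph_diameter :: "'a::euclidean_space set \<Rightarrow> enat" where
  "graph_diameter P = (SUP (u, v) \<in> vertices P \<times> vertices P. edge_distance P u v)"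

definition num_facets :: "'a::euclidean_space set \<Rightarrow> nat" where
  "num_facets P = card {F. F facet_of P}"

text \<open>
  The dimension of a polyhedron is that of its affine span, so the ambient space \<open>'a\<close> is an
  arbitrary Euclidean space, of any dimension at least \<open>d\<close>; in smaller spaces the set below
  is empty.  Taking the supremum in \<open>enat\<close> keeps an unbounded family of diameters visible as
  \<open>\<infinity>\<close>.  A finite supremum of a nonempty set in \<open>enat\<close> is attained, so it is the maximum.
\<close>

definition Delta_u :: "'a::euclidean_space itself \<Rightarrow> nat \<Rightarrow> nat \<Rightarrow> enat" where
  "Delta_u _ d n =
     (SUP P \<in> {P :: 'a set. polyhedron P \<and> aff_dim P = int d \<and> num_facets P = n}.
        graph_diameter P)"

end

theory Submission
  imports Defs
begin

text \<open>
  Two classical bounds are combined.  Let \<open>S\<close> be the set of facets touched by the ball of radius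
  \<open>K + 1\<close> around a vertex.  If dropping all other facets gives a polyhedron in which every vertex
  is within distance \<open>K\<close>, then nothing was dropped; hence a ball of radius one more than the diameter
  for \<open>n div 2\<close> facets touches more than half of the facets.  Two such balls share a facet, which is
  the Kalai--Kleitman recursion, and it works without perturbing to a simple polyhedron.  Larman's
  argument bounds the number of distance layers by \<open>2 ^ (d - 1) * n\<close>, which is at most \<open>n\<^sup>2\<close> here and
  beats the claimed bound for \<open>n \<ge> 64\<close>.  Only \<open>d \<le> 6\<close> then remains; the smallest \<open>n\<close> for
  each such \<open>d\<close> are settled by evaluating the Kalai--Kleitman recursion.
\<close>

section \<open>Vertices and edges of a system of inequalities\<close>

text \<open>Two obstacles shape the comparison of \<open>polyh A S\<close> with
  \<open>polyh A F\<close>. At a degenerate vertex more than d inequalities are tight, so vertices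
  and edges are described by the directions that the tight inequalities leave free, not by counting.
  And the larger polyhedron may leave the smaller one along an unbounded edge, which the graph does
  not see; so the comparison follows any point \<open>z\<close> reached from a vertex in a direction
  that the common tight inequalities determine, whether or not \<open>z\<close> is a vertex.
  Larman's argument rests on connected facet graphs; connectedness is read off from the finite
  distance bound of the recursion. An upper bound n^2 implies the claim as soon as 16 sqrt(3 log n -
  5) \<le> n. At n = 64 this reads 16 sqrt 13 < 64, which explains the threshold.\<close>

text \<open>
  Neither irredundancy of \<open>F\<close> nor \<open>affine hull (polyh A F) = A\<close> is required in what follows, so that
  dropping constraints and passing to facets stay within this class of presentations.
\<close>

definition polyh :: "'a::euclidean_space set \<Rightarrow> ('a \<times> real) set \<Rightarrow> 'a set" where
  "polyh A F = {x \<in> A. \<forall>(a, b) \<in> F. a \<bullet> x \<le> b}"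

definition tight :: "('a::euclidean_space \<times> real) set \<Rightarrow> 'a \<Rightarrow> ('a \<times> real) set" where
  "tight F x = {(a, b) \<in> F. a \<bullet> x = b}"

text \<open>For affine \<open>A\<close> containing \<open>x\<close>, this is the direction space of
  the flat through \<open>x\<close> that is parallel to the hyperplanes of \<open>T\<close>. The
  point \<open>x\<close> only serves to express the directions of \<open>A\<close>, see
  \<open>free_dirs_base\<close>.\<close>

definition free_dirs :: "'a::euclidean_space set \<Rightarrow> ('a \<times> real) set \<Rightarrow> 'a \<Rightarrow> 'a set" where
  "free_dirs A T x = {w. x + w \<in> A \<and> (\<forall>(a, b) \<in> T. a \<bullet> w = 0)}"

lemma polyh_in: "x \<in> polyh A F \<Longrightarrow> x \<in> A"
  and polyh_le: "x \<in> polyh A F \<Longrightarrow> (a, b) \<in> F \<Longrightarrow> a \<bullet> x \<le> b"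
  by (auto simp: polyh_def)

lemma polyhI: "x \<in> A \<Longrightarrow> (\<And>a b. (a, b) \<in> F \<Longrightarrow> a \<bullet> x \<le> b) \<Longrightarrow> x \<in> polyh A F"
  by (auto simp: polyh_def)

lemma polyh_mono: "S \<subseteq> F \<Longrightarrow> polyh A F \<subseteq> polyh A S"
  by (auto simp: polyh_def)

lemma tight_iff: "(a, b) \<in> tight F x \<longleftrightarrow> (a, b) \<in> F \<and> a \<bullet> x = b"
  by (auto simp: tight_def)

lemma tight_subset: "tight F x \<subseteq> F"
  by (auto simp: tight_def)

lemma finite_tight: "finite F \<Longrightarrow> finite (tight F x)"
  by (rule finite_subset[OF tight_subset])

lemma free_dirsD: "w \<in> free_dirs A T x \<Longrightarrow> x + w \<in> A"
    "w \<in> free_dirs A T x \<Longrightarrow> (a, b) \<in> T \<Longrightarrow> a \<bullet> w = 0"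
  by (auto simp: free_dirs_def)

lemma free_dirsI: "x + w \<in> A \<Longrightarrow> (\<And>a b. (a, b) \<in> T \<Longrightarrow> a \<bullet> w = 0) \<Longrightarrow> w \<in> free_dirs A T x"
  by (auto simp: free_dirs_def)

lemma convex_polyh:
  assumes "affine A"
  shows "convex (polyh A F)"
proof -
  have "polyh A F = A \<inter> (\<Inter>(a, b) \<in> F. {x. a \<bullet> x \<le> b})"
    by (auto simp: polyh_def)
  moreover have "convex (\<Inter>(a, b) \<in> F. {x. a \<bullet> x \<le> b})"
    by (intro convex_INT) (auto simp: convex_halfspace_le)
  ultimately show ?thesis
    using affine_imp_convex[OF assms] by (simp add: convex_Int)
qed

lemma affine_shift:
  assumes "affine A" "x \<in> A" "y \<in> A" "x + w \<in> A"
  shows "y + c *\<^sub>R w \<in> A"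
proof -
  have "y + c *\<^sub>R ((x + w) - x) \<in> A"
    by (rule mem_affine_3_minus) (use assms in auto)
  then show ?thesis by simp
qed

lemma free_dirs_base:
  assumes "affine A" "x \<in> A" "y \<in> A"
  shows "free_dirs A T x = free_dirs A T y"
  using affine_shift[OF assms(1), of x y _ 1] affine_shift[OF assms(1), of y x _ 1] assms
  by (auto simp: free_dirs_def)

lemma free_dirs_scaleR:
  assumes "affine A" "x \<in> A" "w \<in> free_dirs A T x"
  shows "c *\<^sub>R w \<in> free_dirs A T x"
  using assms affine_shift[of A x x w c] by (auto simp: free_dirs_def)

lemma free_dirs_diff:
  assumes "affine A" "x \<in> A" "w \<in> free_dirs A T x" "w' \<in> free_dirs A T x"
  shows "w - w' \<in> free_dirs A T x"
proof -
  have "x + w + (-1) *\<^sub>R w' \<in> A"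
    using affine_shift[OF assms(1,2), of "x + w" w' "-1"] assms by (auto simp: free_dirs_def)
  then have "x + (w - w') \<in> A" by (simp add: algebra_simps)
  then show ?thesis
    using free_dirsD(2)[OF assms(3)] free_dirsD(2)[OF assms(4)]
    by (intro free_dirsI) (simp_all add: inner_diff_right)
qed

lemma free_dirs_antimono: "T \<subseteq> T' \<Longrightarrow> free_dirs A T' x \<subseteq> free_dirs A T x"
  by (auto simp: free_dirs_def)

text \<open>Tight inequalities keep their value along \<open>w\<close>, and finitely many slack ones
  leave room for a common small step both ways.\<close>

lemma local_move:
  assumes A: "affine A" and fin: "finite F" and x: "x \<in> polyh A F"
    and w: "w \<in> free_dirs A (tight F x) x"
  obtains e where "e > 0" "x + e *\<^sub>R w \<in> polyh A F" "x - e *\<^sub>R w \<in> polyh A F"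
proof -
  have "eventually (\<lambda>e. \<forall>(a, b) \<in> F - tight F x. e * \<bar>a \<bullet> w\<bar> < b - a \<bullet> x) (at_right (0::real))"
  proof (intro eventually_ball_finite ballI)
    show "finite (F - tight F x)" using fin by simp
    fix h assume h: "h \<in> F - tight F x"
    obtain a b where [simp]: "h = (a, b)" by force
    from h x have "0 < b - a \<bullet> x"
      by (fastforce simp: tight_def polyh_def)
    moreover have "((\<lambda>e. e * \<bar>a \<bullet> w\<bar>) \<longlongrightarrow> 0 * \<bar>a \<bullet> w\<bar>) (at_right 0)"
      by (intro tendsto_intros)
    ultimately have "eventually (\<lambda>e. e * \<bar>a \<bullet> w\<bar> < b - a \<bullet> x) (at_right 0)"
      by (intro order_tendstoD(2)) auto
    then show "eventually (\<lambda>e. case h of (a, b) \<Rightarrow> e * \<bar>a \<bullet> w\<bar> < b - a \<bullet> x) (at_right 0)"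
      by simp
  qed
  then have "eventually (\<lambda>e. e > 0 \<and> (\<forall>(a, b) \<in> F - tight F x. e * \<bar>a \<bullet> w\<bar> < b - a \<bullet> x)) (at_right (0::real))"
    using eventually_at_right_less[of 0] by eventually_elim auto
  then obtain e :: real where e: "e > 0" "\<forall>(a, b) \<in> F - tight F x. e * \<bar>a \<bullet> w\<bar> < b - a \<bullet> x"
    using eventually_happens'[OF trivial_limit_at_right_real] by blast
  have *: "x + s *\<^sub>R w \<in> polyh A F" if s: "\<bar>s\<bar> = e" for s
  proof (rule polyhI)
    show "x + s *\<^sub>R w \<in> A"
      using affine_shift[OF A, of x x w s] x w by (auto simp: polyh_def free_dirs_def)
    fix a b assume ab: "(a, b) \<in> F"
    show "a \<bullet> (x + s *\<^sub>R w) \<le> b"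
    proof (cases "(a, b) \<in> tight F x")
      case True
      then show ?thesis
        using free_dirsD(2)[OF w True] by (simp add: inner_add_right tight_iff)
    next
      case False
      have "s * (a \<bullet> w) \<le> \<bar>s\<bar> * \<bar>a \<bullet> w\<bar>"
        by (metis abs_ge_self abs_mult)
      also have "\<dots> < b - a \<bullet> x"
        using e(2) False ab s by fastforce
      finally show ?thesis by (simp add: inner_add_right)
    qed
  qed
  show ?thesis
    using that[OF e(1)] *[of e] *[of "-e"] e(1) by simp
qed

text \<open>The slack at \<open>z\<close> is a combination, with positive weights, of the
  nonnegative slacks at \<open>x\<close> and \<open>y\<close>; it vanishes only if both do.\<close>

lemma open_segment_tight:
  assumes x: "x \<in> polyh A F" and y: "y \<in> polyh A F" and z: "z \<in> open_segment x y"
  shows "tight F z = tight F x \<inter> tight F y"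
proof -
  obtain u where u: "0 < u" "u < 1" "z = (1 - u) *\<^sub>R x + u *\<^sub>R y"
    using z by (auto simp: in_segment)
  have "a \<bullet> z = b \<longleftrightarrow> a \<bullet> x = b \<and> a \<bullet> y = b" if ab: "(a, b) \<in> F" for a b
  proof
    assume "a \<bullet> x = b \<and> a \<bullet> y = b"
    then show "a \<bullet> z = b" unfolding u(3) by (simp add: inner_add_right algebra_simps)
  next
    assume z: "a \<bullet> z = b"
    have le: "a \<bullet> x \<le> b" "a \<bullet> y \<le> b"
      using x y ab by (auto simp: polyh_def)
    have "(1 - u) * (b - a \<bullet> x) + u * (b - a \<bullet> y) = 0"
      using z u(3) by (simp add: inner_add_right algebra_simps)
    moreover have "(1 - u) * (b - a \<bullet> x) \<ge> 0" "u * (b - a \<bullet> y) \<ge> 0"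
      using le u by auto
    ultimately have "(1 - u) * (b - a \<bullet> x) = 0" "u * (b - a \<bullet> y) = 0" by linarith+
    then show "a \<bullet> x = b \<and> a \<bullet> y = b" using u by auto
  qed
  then show ?thesis by (auto simp: tight_def)
qed

text \<open>A nonzero free direction makes \<open>x\<close> a midpoint by \<open>local_move\<close>;
  conversely, a segment of the polyhedron with \<open>x\<close> in its interior has a free
  direction, because all tight inequalities are tight at both ends.\<close>

lemma vertices_polyh:
  assumes A: "affine A" and fin: "finite F"
  shows "vertices (polyh A F) = {x \<in> polyh A F. free_dirs A (tight F x) x \<subseteq> {0}}"
proof (intro set_eqI iffI)
  fix x assume "x \<in> vertices (polyh A F)"
  then have x: "x \<in> polyh A F" "\<And>p q. p \<in> polyh A F \<Longrightarrow> q \<in> polyh A F \<Longrightarrow> x \<notin> open_segment p q"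
    by (auto simp: vertices_def extreme_point_of_def)
  have "w = 0" if w: "w \<in> free_dirs A (tight F x) x" for w
  proof (rule ccontr)
    assume "w \<noteq> 0"
    obtain e where e: "e > 0" "x + e *\<^sub>R w \<in> polyh A F" "x - e *\<^sub>R w \<in> polyh A F"
      using local_move[OF A fin x(1) w] by blast
    have "midpoint (x + e *\<^sub>R w) (x - e *\<^sub>R w) = x"
      by (simp add: midpoint_def algebra_simps flip: scaleR_2)
    moreover have "x + e *\<^sub>R w \<noteq> x - e *\<^sub>R w"
      using e \<open>w \<noteq> 0\<close> by (auto simp: algebra_simps eq_neg_iff_add_eq_0 simp flip: scaleR_left.add scaleR_2)
    ultimately have "x \<in> open_segment (x + e *\<^sub>R w) (x - e *\<^sub>R w)"
      by (metis midpoint_in_open_segment)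
    then show False using x e by blast
  qed
  then show "x \<in> {x \<in> polyh A F. free_dirs A (tight F x) x \<subseteq> {0}}"
    using x by auto
next
  fix x assume "x \<in> {x \<in> polyh A F. free_dirs A (tight F x) x \<subseteq> {0}}"
  then have x: "x \<in> polyh A F" "free_dirs A (tight F x) x \<subseteq> {0}" by auto
  have "x \<notin> open_segment p q" if p: "p \<in> polyh A F" and q: "q \<in> polyh A F" for p q
  proof
    assume o: "x \<in> open_segment p q"
    have "q - p \<in> free_dirs A (tight F x) x"
    proof (rule free_dirsI)
      show "x + (q - p) \<in> A"
        using affine_shift[OF A, of p x "q - p" 1] p q x by (auto simp: polyh_def)
      show "a \<bullet> (q - p) = 0" if "(a, b) \<in> tight F x" for a b
        using that unfolding open_segment_tight[OF p q o] by (auto simp: tight_def inner_diff_right)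
    qed
    then have "q = p" using x by auto
    then show False using o by auto
  qed
  then show "x \<in> vertices (polyh A F)"
    using x by (auto simp: vertices_def extreme_point_of_def)
qed

text \<open>By \<open>open_segment_tight\<close>, \<open>tight F x \<inter> tight F y\<close> is the
  tight set of every point strictly between \<open>x\<close> and \<open>y\<close>. The criterion
  thus says that such a point can move only along the segment.\<close>

lemma edge_polyh:
  assumes A: "affine A" and fin: "finite F"
  shows "(x, y) \<in> graph_edges (polyh A F) \<longleftrightarrow>
    x \<in> vertices (polyh A F) \<and> y \<in> vertices (polyh A F) \<and> x \<noteq> y \<and>
    free_dirs A (tight F x \<inter> tight F y) x \<subseteq> range (\<lambda>c. c *\<^sub>R (y - x))"
    (is "?L \<longleftrightarrow> ?x \<and> ?y \<and> _ \<and> ?W")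
proof (intro iffI conjI)
  assume L: ?L
  then show ?x and ?y and "x \<noteq> y"
    by (auto simp: graph_edges_def edge_of_def)
  have face: "closed_segment x y face_of polyh A F"
    using L by (auto simp: graph_edges_def edge_of_def)
  have xy: "x \<in> polyh A F" "y \<in> polyh A F"
    using \<open>?x\<close> \<open>?y\<close> by (auto simp: vertices_polyh[OF A fin])
  define m where "m = midpoint x y"
  have mo: "m \<in> open_segment x y" unfolding m_def using \<open>x \<noteq> y\<close> by simp
  then have m: "m \<in> closed_segment x y" by (simp add: open_segment_def)
  have mP: "m \<in> polyh A F" using face m by (auto dest: face_of_imp_subset)
  show ?W
  proof
    fix w assume w: "w \<in> free_dirs A (tight F x \<inter> tight F y) x"
    then have "w \<in> free_dirs A (tight F m) m"
      using free_dirs_base[OF A, of x m] xy mP open_segment_tight[OF xy mo] by (auto simp: polyh_def)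
    then obtain e where e: "e > 0" "m + e *\<^sub>R w \<in> polyh A F" "m - e *\<^sub>R w \<in> polyh A F"
      using local_move[OF A fin mP] by blast
    show "w \<in> range (\<lambda>c. c *\<^sub>R (y - x))"
    proof (cases "w = 0")
      case True
      then have "w = 0 *\<^sub>R (y - x)" by simp
      then show ?thesis by blast
    next
      case False
      have "midpoint (m + e *\<^sub>R w) (m - e *\<^sub>R w) = m"
        by (simp add: midpoint_def algebra_simps flip: scaleR_2)
      moreover have "m + e *\<^sub>R w \<noteq> m - e *\<^sub>R w"
        using e False by (auto simp: algebra_simps eq_neg_iff_add_eq_0 simp flip: scaleR_left.add scaleR_2)
      ultimately have "m \<in> open_segment (m + e *\<^sub>R w) (m - e *\<^sub>R w)"
        by (metis midpoint_in_open_segment)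
      then have "m + e *\<^sub>R w \<in> closed_segment x y"
        using face m e by (auto simp: face_of_def)
      then obtain u where u: "m + e *\<^sub>R w = (1 - u) *\<^sub>R x + u *\<^sub>R y"
        by (auto simp: in_segment)
      have "2 *\<^sub>R m = x + y"
        by (simp add: m_def midpoint_def)
      moreover have "2 *\<^sub>R (m + e *\<^sub>R w) = 2 *\<^sub>R ((1 - u) *\<^sub>R x + u *\<^sub>R y)"
        using u by simp
      ultimately have "(2 * e) *\<^sub>R w = (2 * u - 1) *\<^sub>R (y - x)"
        by (simp add: algebra_simps) (simp add: scaleR_2)
      then have "(1 / (2 * e)) *\<^sub>R (2 * e) *\<^sub>R w = (1 / (2 * e)) *\<^sub>R (2 * u - 1) *\<^sub>R (y - x)"
        by (rule arg_cong)
      then have "w = ((2 * u - 1) / (2 * e)) *\<^sub>R (y - x)" using e(1) by simp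
      then show ?thesis by blast
    qed
  qed
next
  assume R: "?x \<and> ?y \<and> x \<noteq> y \<and> ?W"
  have xy: "x \<in> polyh A F" "y \<in> polyh A F"
    using R by (auto simp: vertices_polyh[OF A fin])
  have ext: "\<And>p q. p \<in> polyh A F \<Longrightarrow> q \<in> polyh A F \<Longrightarrow> x \<notin> open_segment p q \<and> y \<notin> open_segment p q"
    using R by (auto simp: vertices_def extreme_point_of_def)
  have sub: "closed_segment x y \<subseteq> polyh A F"
    by (rule closed_segment_subset[OF xy convex_polyh[OF A]])
  \<comment> \<open>The common equations confine \<open>p\<close> to the line through
    \<open>x\<close> and \<open>y\<close>. Beyond either end, \<open>p\<close> would put that end
    inside an open segment, contradicting extremality.\<close>
  have key: "p \<in> closed_segment x y"
    if p: "p \<in> polyh A F" and T: "tight F x \<inter> tight F y \<subseteq> tight F p" for p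
  proof -
    have "p - x \<in> free_dirs A (tight F x \<inter> tight F y) x"
      using p T by (intro free_dirsI) (auto simp: polyh_def tight_def inner_diff_right)
    then obtain c where "p - x = c *\<^sub>R (y - x)" using R by blast
    then have c: "p = (1 - c) *\<^sub>R x + c *\<^sub>R y" by (simp add: algebra_simps)
    have "c \<ge> 0"
    proof (rule ccontr)
      assume "\<not> c \<ge> 0"
      then have "c < 0" by simp
      have "x = (1 - (-c) / (1 - c)) *\<^sub>R p + ((-c) / (1 - c)) *\<^sub>R y"
      proof -
        have "(1 - c) *\<^sub>R x = p - c *\<^sub>R y" using c by simp
        then have "(1 / (1 - c)) *\<^sub>R (1 - c) *\<^sub>R x = (1 / (1 - c)) *\<^sub>R (p - c *\<^sub>R y)"
          by (rule arg_cong)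
        then have "x = (1 / (1 - c)) *\<^sub>R (p - c *\<^sub>R y)"
          using \<open>c < 0\<close> by simp
        moreover have "1 - (-c) / (1 - c) = 1 / (1 - c)" using \<open>c < 0\<close> by (simp add: field_simps)
        ultimately show ?thesis by (simp add: scaleR_diff_right)
      qed
      moreover have "0 < (-c) / (1 - c)" "(-c) / (1 - c) < 1" using \<open>c < 0\<close> by (auto simp: field_simps)
      moreover have "p \<noteq> y"
      proof
        assume "p = y"
        then have "(1 - c) *\<^sub>R (x - y) = 0" using c by (simp add: algebra_simps)
        then show False using \<open>c < 0\<close> R by auto
      qed
      ultimately have "x \<in> open_segment p y" unfolding in_segment by blast
      then show False using ext p xy by blast
    qed
    moreover have "c \<le> 1"
    proof (rule ccontr)
      assume "\<not> c \<le> 1"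
      then have "c > 1" by simp
      have "y = (1 - 1 / c) *\<^sub>R x + (1 / c) *\<^sub>R p"
        using \<open>c > 1\<close> unfolding c by (simp add: algebra_simps)
      moreover have "0 < 1 / c" "1 / c < 1" using \<open>c > 1\<close> by auto
      moreover have "x \<noteq> p"
      proof
        assume "x = p"
        then have "c *\<^sub>R (x - y) = 0" using c by (simp add: algebra_simps)
        then show False using \<open>c > 1\<close> R by auto
      qed
      ultimately have "y \<in> open_segment x p" unfolding in_segment by blast
      then show False using ext p xy by blast
    qed
    ultimately show ?thesis using c by (auto simp: in_segment)
  qed
  have "closed_segment x y face_of polyh A F"
    unfolding face_of_def
  proof (intro conjI ballI impI)
    show "closed_segment x y \<subseteq> polyh A F" "convex (closed_segment x y)" using sub by auto
    fix p q z assume p: "p \<in> polyh A F" and q: "q \<in> polyh A F"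
      and z: "z \<in> closed_segment x y" and o: "z \<in> open_segment p q"
    obtain u where u: "z = (1 - u) *\<^sub>R x + u *\<^sub>R y"
      using z by (auto simp: in_segment)
    have "tight F x \<inter> tight F y \<subseteq> tight F z"
      unfolding u by (auto simp: tight_def inner_add_right algebra_simps)
    then have "tight F x \<inter> tight F y \<subseteq> tight F p \<and> tight F x \<inter> tight F y \<subseteq> tight F q"
      using open_segment_tight[OF p q o] by auto
    then show "p \<in> closed_segment x y" "q \<in> closed_segment x y" using key p q by auto
  qed
  moreover have "aff_dim (closed_segment x y) = 1"
    using R by (simp add: segment_convex_hull aff_dim_convex_hull aff_dim_2)
  ultimately show ?L using R by (auto simp: graph_edges_def edge_of_def)
qed

lemma sym_graph_edges: "sym (graph_edges P)"
  by (auto simp: sym_def graph_edges_def closed_segment_commute)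

text \<open>The ratio test of the simplex method: the step length is the least quotient of slack by
  speed over the inequalities that \<open>w\<close> approaches.\<close>

lemma exit_point:
  assumes A: "affine A" and fin: "finite F" and x: "x \<in> polyh A F" and w: "x + w \<in> A"
    and up: "\<exists>(a, b) \<in> F. a \<bullet> w > 0"
  obtains t a b where "t \<ge> 0" "x + t *\<^sub>R w \<in> polyh A F" "(a, b) \<in> F" "a \<bullet> w > 0" "a \<bullet> (x + t *\<^sub>R w) = b"
proof -
  define V where "V = {(a, b) \<in> F. a \<bullet> w > 0}"
  define r where "r = (\<lambda>(a, b). (b - a \<bullet> x) / (a \<bullet> w))"
  have V: "finite V" "V \<noteq> {}"
    using fin up by (auto simp: V_def intro: finite_subset[of _ F])
  then obtain h where h: "h \<in> V" "\<And>h'. h' \<in> V \<Longrightarrow> r h \<le> r h'"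
    using arg_min_if_finite[OF V, of r] by (metis not_le)
  obtain a b where [simp]: "h = (a, b)" by force
  have ab: "(a, b) \<in> F" "a \<bullet> w > 0" using h(1) by (auto simp: V_def)
  show thesis
  proof (rule that[of "r h" a b])
    show "r h \<ge> 0" using ab polyh_le[OF x ab(1)] by (simp add: r_def)
    show "(a, b) \<in> F" "a \<bullet> w > 0" by fact+
    show "a \<bullet> (x + r h *\<^sub>R w) = b" using ab by (simp add: r_def inner_add_right)
    show "x + r h *\<^sub>R w \<in> polyh A F"
    proof (rule polyhI)
      show "x + r h *\<^sub>R w \<in> A" using affine_shift[OF A _ _ w] x by (auto simp: polyh_def)
      fix c e assume ce: "(c, e) \<in> F"
      have le: "c \<bullet> x \<le> e" by (rule polyh_le[OF x ce])
      show "c \<bullet> (x + r h *\<^sub>R w) \<le> e"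
      proof (cases "c \<bullet> w > 0")
        case True
        then have "r h \<le> (e - c \<bullet> x) / (c \<bullet> w)" using h(2)[of "(c, e)"] ce by (simp add: V_def r_def)
        then show ?thesis using True by (simp add: inner_add_right field_simps)
      next
        case False
        then have "r h * (c \<bullet> w) \<le> 0"
          using \<open>r h \<ge> 0\<close> by (simp add: mult_nonneg_nonpos)
        then show ?thesis using le by (simp add: inner_add_right)
      qed
    qed
  qed
qed

lemma polyhedron_eq_polyh:
  assumes "polyhedron P" "P \<noteq> {}"
  obtains F where "finite F" "card F \<le> num_facets P" "P = polyh (affine hull P) F"
proof -
  obtain H where H: "finite H" "P = affine hull P \<inter> \<Inter>H"
    "\<forall>h\<in>H. \<exists>a b. a \<noteq> 0 \<and> h = {x. a \<bullet> x \<le> b}" "\<forall>H'. H' \<subset> H \<longrightarrow> P \<subset> affine hull P \<inter> \<Inter>H'"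
    using assms(1) by (subst (asm) polyhedron_Int_affine_minimal) blast
  then obtain a b where ab: "\<And>h. h \<in> H \<Longrightarrow> a h \<noteq> 0 \<and> h = {x. a h \<bullet> x \<le> b h}"
    by metis
  note min = H(4)[rule_format]
  have facets: "C facet_of P \<longleftrightarrow> (\<exists>h. h \<in> H \<and> C = P \<inter> {x. a h \<bullet> x = b h})" for C
    by (rule facet_of_polyhedron_explicit[OF H(1,2) ab min])
  have mem: "x \<in> P \<longleftrightarrow> x \<in> affine hull P \<and> (\<forall>h\<in>H. a h \<bullet> x \<le> b h)" for x
  proof -
    have "x \<in> h \<longleftrightarrow> a h \<bullet> x \<le> b h" if "h \<in> H" for h using ab[OF that] by blast
    then have "x \<in> \<Inter>H \<longleftrightarrow> (\<forall>h\<in>H. a h \<bullet> x \<le> b h)" by blast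
    then show ?thesis using H(2) by blast
  qed
  obtain x where x: "x \<in> P" "\<And>h. h \<in> H \<Longrightarrow> a h \<bullet> x < b h"
  proof -
    have "rel_interior P \<noteq> {}"
      using assms polyhedron_imp_convex rel_interior_eq_empty by blast
    moreover have "rel_interior P = {x \<in> P. \<forall>h\<in>H. a h \<bullet> x < b h}"
      by (rule rel_interior_polyhedron_explicit[OF H(1,2) ab min])
    ultimately show ?thesis using that by blast
  qed
  \<comment> \<open>Distinct halfspaces of a minimal family give distinct facets: join a relative
    interior point \<open>x\<close> to a point \<open>z\<close> of the hull that violates
    \<open>h\<close> alone. The segment crosses the hyperplane of \<open>h\<close> at a point
    strictly inside all other halfspaces.\<close>
  have "inj_on (\<lambda>h. P \<inter> {x. a h \<bullet> x = b h}) H"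
  proof (rule inj_onI, rule ccontr)
    fix h h' assume h: "h \<in> H" "h' \<in> H" "h \<noteq> h'"
      and eq: "P \<inter> {x. a h \<bullet> x = b h} = P \<inter> {x. a h' \<bullet> x = b h'}"
    have "H - {h} \<subset> H" using h(1) by blast
    from min[OF this] obtain z where z: "z \<in> affine hull P" "z \<in> \<Inter>(H - {h})" "z \<notin> P" by blast
    have zle: "a g \<bullet> z \<le> b g" if "g \<in> H" "g \<noteq> h" for g
      using ab[OF that(1)] z(2) that by blast
    then have zh: "a h \<bullet> z > b h" using z(1,3) mem not_le by blast
    define t where "t = (b h - a h \<bullet> x) / (a h \<bullet> z - a h \<bullet> x)"
    have t: "0 < t" "t < 1" using x(2)[OF h(1)] zh by (auto simp: t_def field_simps)
    define y where "y = (1 - t) *\<^sub>R x + t *\<^sub>R z"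
    have "a h \<bullet> y = a h \<bullet> x + t * (a h \<bullet> z - a h \<bullet> x)" by (simp add: y_def inner_add_right algebra_simps)
    then have yh: "a h \<bullet> y = b h" using x(2)[OF h(1)] zh by (simp add: t_def)
    have less: "a g \<bullet> y < b g" if "g \<in> H" "g \<noteq> h" for g
    proof -
      have "(1 - t) * (a g \<bullet> x) < (1 - t) * b g" using x(2)[OF that(1)] t by simp
      moreover have "t * (a g \<bullet> z) \<le> t * b g" using zle[OF that] t by simp
      ultimately show ?thesis by (simp add: y_def inner_add_right algebra_simps)
    qed
    have "y \<in> affine hull P"
      unfolding y_def by (rule mem_affine) (use x z hull_inc in auto)
    then have "y \<in> P" using mem yh less by (metis less_eq_real_def)
    then have "a h' \<bullet> y = b h'" using eq yh by blast
    then show False using less[of h'] h by auto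
  qed
  then have "card H \<le> num_facets P"
    unfolding num_facets_def using facets finite_polyhedron_facets[OF assms(1)]
    by (intro card_inj_on_le) auto
  moreover have "card ((\<lambda>h. (a h, b h)) ` H) \<le> card H" by (rule card_image_le[OF H(1)])
  moreover have "P = polyh (affine hull P) ((\<lambda>h. (a h, b h)) ` H)"
    using mem unfolding polyh_def by auto
  ultimately show ?thesis using that[of "(\<lambda>h. (a h, b h)) ` H"] H(1) by simp
qed

section \<open>Dropping the facets far from a vertex\<close>

text \<open>If \<open>z\<close> were outside, the segment from \<open>x\<close> would leave
  \<open>polyh A F\<close> at some \<open>y\<close> through an inequality not in \<open>S\<close>,
  since \<open>z\<close> lies further on and satisfies \<open>S\<close>. But \<open>y\<close> is
  then a neighbour of \<open>x\<close>, so this inequality does belong to \<open>S\<close>. As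
  \<open>z\<close> is not assumed to be a vertex, rays are covered too.\<close>

lemma edge_direction_stays_in:
  assumes A: "affine A" and fin: "finite F" and S: "S \<subseteq> F"
    and x: "x \<in> vertices (polyh A F)" and tx: "tight F x \<subseteq> S"
    and z: "z \<in> polyh A S"
    and dirs: "free_dirs A (tight S x \<inter> tight S z) x \<subseteq> range (\<lambda>c. c *\<^sub>R (z - x))"
    and nbr: "\<And>y. (x, y) \<in> graph_edges (polyh A F) \<Longrightarrow> tight F y \<subseteq> S"
  shows "z \<in> polyh A F"
proof (rule ccontr)
  assume nz: "z \<notin> polyh A F"
  define w where "w = z - x"
  have xP: "x \<in> polyh A F" using x by (simp add: vertices_polyh[OF A fin])
  have zw: "z = x + w" by (simp add: w_def)
  have zA: "z \<in> A" using z by (rule polyh_in)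
  then obtain a0 b0 where "(a0, b0) \<in> F" "a0 \<bullet> z > b0"
    using nz by (force simp: polyh_def)
  then have "\<exists>(a, b) \<in> F. a \<bullet> w > 0"
    using polyh_le[OF xP, of a0 b0]
    by (intro bexI[of _ "(a0, b0)"]) (auto simp: w_def inner_diff_right)
  then obtain t a b where t: "t \<ge> 0" and yP: "x + t *\<^sub>R w \<in> polyh A F"
    and ab: "(a, b) \<in> F" "a \<bullet> w > 0" "a \<bullet> (x + t *\<^sub>R w) = b"
    using exit_point[OF A fin xP, of w] zA zw by metis
  define y where "y = x + t *\<^sub>R w"
  have "w \<noteq> 0" using ab by auto
  have "t < 1"
  proof (rule ccontr)
    assume "\<not> t < 1"
    then have "z = (1 - 1 / t) *\<^sub>R x + (1 / t) *\<^sub>R y" "0 \<le> 1 / t" "1 / t \<le> 1"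
      by (auto simp: zw y_def algebra_simps)
    then have "z \<in> closed_segment x y" unfolding in_segment by blast
    then show False
      using nz closed_segment_subset[OF xP _ convex_polyh[OF A], of y] yP y_def by auto
  qed
  have "(a, b) \<notin> S"
  proof
    assume "(a, b) \<in> S"
    then have "a \<bullet> x + a \<bullet> w \<le> a \<bullet> x + t * (a \<bullet> w)"
      using polyh_le[OF z] ab(3) by (simp add: zw inner_add_right)
    then show False using \<open>t < 1\<close> ab(2) by simp
  qed
  then have hx: "(a, b) \<notin> tight F x" using tx by blast
  have hy: "(a, b) \<in> tight F y" using ab by (simp add: tight_iff y_def)
  have "t > 0"
    using hy hx t by (cases "t = 0") (auto simp: y_def)
  have "y = (1 - t) *\<^sub>R x + t *\<^sub>R z" by (simp add: y_def w_def algebra_simps)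
  moreover have "x \<noteq> z" using \<open>w \<noteq> 0\<close> by (simp add: w_def)
  ultimately have yo: "y \<in> open_segment x z"
    using \<open>t > 0\<close> \<open>t < 1\<close> unfolding in_segment by blast
  have xS: "x \<in> polyh A S" using polyh_mono[OF S] xP by blast
  have ty: "tight S y = tight S x \<inter> tight S z"
    by (rule open_segment_tight[OF xS z yo])
  have SF: "tight S p \<subseteq> tight F p" for p using S by (auto simp: tight_def)
  \<comment> \<open>The inequalities of \<open>S\<close> tight at \<open>y\<close> leave only
    multiples of \<open>w\<close>, and the newly tight \<open>(a, b)\<close> with
    \<open>a \<bullet> w > 0\<close> rules out the nonzero ones.\<close>
  have "free_dirs A (tight F y) y \<subseteq> {0}"
  proof
    fix w' assume w': "w' \<in> free_dirs A (tight F y) y"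
    then have "w' \<in> free_dirs A (tight F y) x"
      using free_dirs_base[OF A, of y x] yP xP by (auto simp: polyh_def y_def)
    then have "w' \<in> free_dirs A (tight S x \<inter> tight S z) x"
      using free_dirs_antimono[of "tight S x \<inter> tight S z" "tight F y" A x] ty SF by auto
    then obtain c where c: "w' = c *\<^sub>R w" using dirs by (auto simp: w_def)
    have "a \<bullet> w' = 0" using free_dirsD(2)[OF w' hy] .
    then show "w' \<in> {0}" using c ab by auto
  qed
  then have yv: "y \<in> vertices (polyh A F)"
    using yP by (simp add: vertices_polyh[OF A fin] y_def)
  have "(x, y) \<in> graph_edges (polyh A F)"
    unfolding edge_polyh[OF A fin]
  proof (intro conjI x yv subsetI)
    show "x \<noteq> y" using hx hy by auto
    fix w' assume "w' \<in> free_dirs A (tight F x \<inter> tight F y) x"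
    moreover have "tight S x \<inter> tight S z \<subseteq> tight F x \<inter> tight F y" using ty SF by blast
    ultimately have "w' \<in> free_dirs A (tight S x \<inter> tight S z) x"
      using free_dirs_antimono by blast
    then obtain c where "w' = c *\<^sub>R w" using dirs by (auto simp: w_def)
    then have "w' = (c / t) *\<^sub>R (y - x)" using \<open>t > 0\<close> by (simp add: y_def)
    then show "w' \<in> range (\<lambda>c. c *\<^sub>R (y - x))" by blast
  qed
  then have "tight F y \<subseteq> S" by (rule nbr)
  then show False using hy \<open>(a, b) \<notin> S\<close> by auto
qed

text \<open>A polyhedron with a vertex is the convex hull of its vertices and its edges, unbounded
  ones included. Induction on the number of slack inequalities: a point is written between two
  points with fewer, until it sits on such an edge.\<close>

lemma polyh_subset_of_skeleton:
  assumes A: "affine A" and fin: "finite S" and v: "v \<in> vertices (polyh A S)"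
    and C: "convex C" and vC: "vertices (polyh A S) \<subseteq> C"
    and eC: "\<And>x z. x \<in> vertices (polyh A S) \<Longrightarrow> z \<in> polyh A S \<Longrightarrow>
      free_dirs A (tight S x \<inter> tight S z) x \<subseteq> range (\<lambda>c. c *\<^sub>R (z - x)) \<Longrightarrow> z \<in> C"
  shows "polyh A S \<subseteq> C"
proof
  \<comment> \<open>Since there is a vertex, a recession direction \<open>w\<close> on which
    \<open>c\<close> vanishes is zero: all its products with the normals are nonpositive and sum to
    0. Hence the slices of constant \<open>c\<close> are bounded.\<close>
  define c where "c = (\<Sum>h\<in>S. fst h)"
  have vQ: "v \<in> polyh A S" "free_dirs A (tight S v) v \<subseteq> {0}"
    using v by (auto simp: vertices_polyh[OF A fin])
  have up: "\<exists>(a, b) \<in> S. a \<bullet> w > 0"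
    if "x + w \<in> A" "x \<in> A" "w \<noteq> 0" "c \<bullet> w = 0" for x w
  proof (rule ccontr)
    assume "\<not> ?thesis"
    then have le: "\<And>h. h \<in> S \<Longrightarrow> fst h \<bullet> w \<le> 0" by force
    have "(\<Sum>h\<in>S. - (fst h \<bullet> w)) = 0"
      using that by (simp add: c_def inner_sum_left sum_negf)
    then have "\<forall>h\<in>S. fst h \<bullet> w = 0"
      using sum_nonneg_eq_0_iff[OF fin, of "\<lambda>h. - (fst h \<bullet> w)"] le by simp
    then have "w \<in> free_dirs A (tight S v) v"
      using affine_shift[OF A, of x v w 1] that vQ(1)
      by (intro free_dirsI) (auto simp: polyh_def tight_def)
    then show False using vQ that by auto
  qed
  fix z assume "z \<in> polyh A S"
  then show "z \<in> C"
  proof (induction "card (S - tight S z)" arbitrary: z rule: less_induct)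
    case less
    then have zQ: "z \<in> polyh A S" by simp
    then have zA: "z \<in> A" by (rule polyh_in)
    let ?W = "free_dirs A (tight S z) z"
    have move: "\<exists>t \<ge> 0. z + t *\<^sub>R w \<in> polyh A S \<and> tight S z \<subseteq> tight S (z + t *\<^sub>R w) \<and>
        (\<exists>(a, b) \<in> tight S (z + t *\<^sub>R w) - tight S z. a \<bullet> w > 0)"
      if w: "w \<in> ?W" and u: "\<exists>(a, b) \<in> S. a \<bullet> w > 0" for w
    proof -
      obtain t a b where t: "t \<ge> 0" "z + t *\<^sub>R w \<in> polyh A S"
        "(a, b) \<in> S" "a \<bullet> w > 0" "a \<bullet> (z + t *\<^sub>R w) = b"
        using exit_point[OF A fin zQ free_dirsD(1)[OF w] u] by metis
      have "tight S z \<subseteq> tight S (z + t *\<^sub>R w)"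
        using free_dirsD(2)[OF w] by (auto simp: tight_def inner_add_right)
      moreover have "(a, b) \<in> tight S (z + t *\<^sub>R w) - tight S z"
        using free_dirsD(2)[OF w, of a b] t by (auto simp: tight_iff)
      ultimately show ?thesis using t by blast
    qed
    have IH: "z' \<in> C" if "z' \<in> polyh A S" "tight S z \<subseteq> tight S z'" "(a, b) \<in> tight S z' - tight S z" for z' a b
    proof (rule less.hyps[OF _ that(1)])
      have "S - tight S z' \<subset> S - tight S z" using that tight_subset[of S z'] by blast
      then show "card (S - tight S z') < card (S - tight S z)"
        using fin by (intro psubset_card_mono) auto
    qed
    consider "?W \<subseteq> {0}" | w where "w \<in> ?W" "w \<noteq> 0" "c \<bullet> w = 0"
      | w0 where "w0 \<in> ?W" "w0 \<noteq> 0" "\<And>w. w \<in> ?W \<Longrightarrow> c \<bullet> w = 0 \<Longrightarrow> w = 0"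
      by blast
    then show ?case
    proof cases
      case 1
      then show ?thesis using vC zQ by (auto simp: vertices_polyh[OF A fin])
    next
      \<comment> \<open>Within the slice, both \<open>w\<close> and \<open>- w\<close> run into a
        new inequality, so \<open>z\<close> lies between two points with more tight
        inequalities.\<close>
      case (2 w)
      have w': "- w \<in> ?W" using free_dirs_scaleR[OF A zA 2(1), of "-1"] by simp
      obtain t1 a1 b1 where t1: "t1 \<ge> 0" "z + t1 *\<^sub>R w \<in> polyh A S" "tight S z \<subseteq> tight S (z + t1 *\<^sub>R w)"
        "(a1, b1) \<in> tight S (z + t1 *\<^sub>R w) - tight S z"
        using move[OF 2(1)] up[OF free_dirsD(1)[OF 2(1)] zA] 2 by blast
      obtain t2 a2 b2 where t2: "t2 \<ge> 0" "z + t2 *\<^sub>R (- w) \<in> polyh A S" "tight S z \<subseteq> tight S (z + t2 *\<^sub>R (- w))"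
        "(a2, b2) \<in> tight S (z + t2 *\<^sub>R (- w)) - tight S z"
        using move[OF w'] up[OF free_dirsD(1)[OF w'] zA] 2 by force
      have mem: "z + t1 *\<^sub>R w \<in> C" "z + t2 *\<^sub>R (- w) \<in> C"
        using IH t1 t2 by blast+
      have "t1 > 0" using t1 by (cases "t1 = 0") auto
      define u where "u = t1 / (t1 + t2)"
      have "t1 = u * (t1 + t2)"
        using \<open>t1 > 0\<close> t2(1) by (simp add: u_def)
      then have "(1 - u) * t1 - u * t2 = 0" by (simp add: algebra_simps)
      moreover have "(1 - u) *\<^sub>R (z + t1 *\<^sub>R w) + u *\<^sub>R (z + t2 *\<^sub>R (- w)) = z + ((1 - u) * t1 - u * t2) *\<^sub>R w"
        by (simp add: algebra_simps)
      ultimately have "z = (1 - u) *\<^sub>R (z + t1 *\<^sub>R w) + u *\<^sub>R (z + t2 *\<^sub>R (- w))"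
        by simp
      moreover have "0 \<le> u" "u \<le> 1"
        using \<open>t1 > 0\<close> t2(1) by (auto simp: u_def)
      ultimately have "z \<in> closed_segment (z + t1 *\<^sub>R w) (z + t2 *\<^sub>R (- w))"
        unfolding in_segment by blast
      then show ?thesis using closed_segment_subset[OF mem C] by blast
    next
      \<comment> \<open>Here \<open>c\<close> is injective on the free directions, so they form a
        line. Following it in an orientation that meets an inequality ends at a vertex, and
        \<open>z\<close> lies on an edge or ray from there.\<close>
      case (3 w0)
      have c0: "c \<bullet> w0 \<noteq> 0" using 3 by blast
      have span: "\<exists>s. w = s *\<^sub>R w0" if w: "w \<in> ?W" for w
      proof -
        let ?s = "(c \<bullet> w) / (c \<bullet> w0)"
        have "w - ?s *\<^sub>R w0 \<in> ?W"
          by (rule free_dirs_diff[OF A zA w free_dirs_scaleR[OF A zA 3(1)]])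
        moreover have "c \<bullet> (w - ?s *\<^sub>R w0) = 0" using c0 by (simp add: inner_diff_right)
        ultimately have "w - ?s *\<^sub>R w0 = 0" by (rule 3(3))
        then show ?thesis by auto
      qed
      obtain w where w: "w \<in> ?W" "w \<noteq> 0" "\<exists>(a, b) \<in> S. a \<bullet> w > 0" "\<And>w'. w' \<in> ?W \<Longrightarrow> \<exists>s. w' = s *\<^sub>R w"
      proof (cases "\<exists>(a, b) \<in> S. a \<bullet> w0 > 0")
        case True
        then show ?thesis using that 3 span by blast
      next
        case False
        have m: "- w0 \<in> ?W" using free_dirs_scaleR[OF A zA 3(1), of "-1"] by simp
        have "\<exists>(a, b) \<in> S. a \<bullet> (- w0) > 0"
        proof (rule ccontr)
          assume "\<not> ?thesis"
          then have "\<forall>h\<in>S. fst h \<bullet> w0 = 0" using False by force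
          then have "c \<bullet> w0 = 0" by (simp add: c_def inner_sum_left)
          then show False using c0 by simp
        qed
        moreover have "\<exists>s. w' = s *\<^sub>R (- w0)" if w': "w' \<in> ?W" for w'
        proof -
          obtain s where "w' = s *\<^sub>R w0" using span[OF w'] by blast
          then have "w' = (- s) *\<^sub>R (- w0)" by simp
          then show ?thesis by blast
        qed
        ultimately show ?thesis using that[OF m] 3 by auto
      qed
      obtain t a b where t: "t \<ge> 0" "z + t *\<^sub>R w \<in> polyh A S" "tight S z \<subseteq> tight S (z + t *\<^sub>R w)"
        and ab: "(a, b) \<in> tight S (z + t *\<^sub>R w) - tight S z" "a \<bullet> w > 0"
        using move[OF w(1,3)] by blast
      define x where "x = z + t *\<^sub>R w"
      have xA: "x \<in> A" using t(2) polyh_in x_def by blast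
      have "t > 0" using t(1) ab by (cases "t = 0") auto
      have xW: "free_dirs A T x = free_dirs A T z" for T
        by (rule free_dirs_base[OF A xA zA])
      have "free_dirs A (tight S x) x \<subseteq> {0}"
      proof
        fix w' assume w': "w' \<in> free_dirs A (tight S x) x"
        then have "w' \<in> ?W" using free_dirs_antimono[OF t(3), of A z] xW by (auto simp: x_def)
        then obtain s where s: "w' = s *\<^sub>R w" using w(4) by blast
        have "a \<bullet> w' = 0" using free_dirsD(2)[OF w'] ab by (auto simp: x_def)
        then show "w' \<in> {0}" using s ab by auto
      qed
      then have xv: "x \<in> vertices (polyh A S)"
        using t(2) by (simp add: vertices_polyh[OF A fin] x_def)
      have "tight S x \<inter> tight S z = tight S z" using t(3) x_def by auto
      moreover have "free_dirs A (tight S z) x \<subseteq> range (\<lambda>c. c *\<^sub>R (z - x))"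
      proof
        fix w' assume "w' \<in> free_dirs A (tight S z) x"
        then obtain s where "w' = s *\<^sub>R w" using w(4) xW by blast
        then have "w' = (- s / t) *\<^sub>R (z - x)" using \<open>t > 0\<close> by (simp add: x_def)
        then show "w' \<in> range (\<lambda>c. c *\<^sub>R (z - x))" by blast
      qed
      ultimately show ?thesis using eC[OF xv zQ] by simp
    qed
  qed
qed

text \<open>An edge of \<open>polyh A S\<close> leaving \<open>polyh A F\<close> would do so through a facet touched at distance
  at most \<open>K + 1\<close> from \<open>v\<close>, which is in \<open>S\<close>.\<close>

lemma ball_facets_define:
  fixes A F v K
  defines "S \<equiv> {h \<in> F. \<exists>j\<le>Suc K. \<exists>y. (v, y) \<in> graph_edges (polyh A F) ^^ j \<and> h \<in> tight F y}"
  assumes A: "affine A" and fin: "finite F" and v: "v \<in> vertices (polyh A F)"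
    and Q: "\<And>y. y \<in> vertices (polyh A S) \<Longrightarrow> \<exists>j\<le>K. (v, y) \<in> graph_edges (polyh A S) ^^ j"
  shows "polyh A S = polyh A F"
proof
  let ?P = "polyh A F" and ?Q = "polyh A S"
  have SF: "S \<subseteq> F" by (auto simp: S_def)
  have finS: "finite S" by (rule finite_subset[OF SF fin])
  show PQ: "?P \<subseteq> ?Q" by (rule polyh_mono[OF SF])
  have tS: "tight F y \<subseteq> S" if "(v, y) \<in> graph_edges ?P ^^ j" "j \<le> Suc K" for y j
    using that tight_subset[of F y] by (auto simp: S_def)
  have vert: "y \<in> vertices ?P" if "(v, y) \<in> graph_edges ?P ^^ j" for y j
    using that v by (cases j) (auto simp: graph_edges_def)
  \<comment> \<open>The radius \<open>K + 1\<close> in \<open>S\<close> is chosen for this: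
    \<open>x\<close> is within distance \<open>K\<close>, so the inequalities tight at its
    neighbours are all in \<open>S\<close>.\<close>
  have stay: "z \<in> ?P" if x: "(v, x) \<in> graph_edges ?P ^^ j" "j \<le> K" and z: "z \<in> ?Q"
    and dirs: "free_dirs A (tight S x \<inter> tight S z) x \<subseteq> range (\<lambda>c. c *\<^sub>R (z - x))" for x z j
  proof (rule edge_direction_stays_in[OF A fin SF vert[OF x(1)] _ z dirs])
    show "tight F x \<subseteq> S" using tS x by simp
    fix y assume "(x, y) \<in> graph_edges ?P"
    then have "(v, y) \<in> graph_edges ?P ^^ Suc j" using x by auto
    from tS[OF this] show "tight F y \<subseteq> S" using x(2) by simp
  qed
  have vP: "x \<in> vertices ?P" if "x \<in> vertices ?Q" "x \<in> ?P" for x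
  proof -
    have "tight S x \<subseteq> tight F x" using SF by (auto simp: tight_def)
    then have "free_dirs A (tight F x) x \<subseteq> free_dirs A (tight S x) x" by (rule free_dirs_antimono)
    then show ?thesis
      using that by (auto simp: vertices_polyh[OF A fin] vertices_polyh[OF A finS])
  qed
  \<comment> \<open>Each edge of \<open>?Q\<close> that starts at a vertex already reached in
    \<open>?P\<close> ends in \<open>?P\<close> by \<open>stay\<close>. It remains an edge there
    because passing from \<open>S\<close> to \<open>F\<close> only enlarges tight sets.\<close>
  have walk: "(v, x) \<in> graph_edges ?P ^^ j" if "(v, x) \<in> graph_edges ?Q ^^ j" "j \<le> K" for x j
    using that
  proof (induction j arbitrary: x)
    case 0
    then show ?case by simp
  next
    case (Suc j)
    then obtain y where y: "(v, y) \<in> graph_edges ?Q ^^ j" "(y, x) \<in> graph_edges ?Q" by auto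
    have vy: "(v, y) \<in> graph_edges ?P ^^ j" using Suc y by simp
    have e: "x \<in> vertices ?Q" "x \<in> ?Q" "y \<noteq> x"
      "free_dirs A (tight S y \<inter> tight S x) y \<subseteq> range (\<lambda>c. c *\<^sub>R (x - y))"
      using y(2) by (auto simp: edge_polyh[OF A finS] vertices_polyh[OF A finS])
    have xP: "x \<in> ?P" using stay[OF vy _ e(2) e(4)] Suc.prems by simp
    have "tight S y \<inter> tight S x \<subseteq> tight F y \<inter> tight F x" using SF by (auto simp: tight_def)
    then have "free_dirs A (tight F y \<inter> tight F x) y \<subseteq> range (\<lambda>c. c *\<^sub>R (x - y))"
      using free_dirs_antimono e(4) by blast
    then have "(y, x) \<in> graph_edges ?P"
      using vert[OF vy] vP[OF e(1) xP] e(3) by (simp add: edge_polyh[OF A fin])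
    then show ?case using vy by auto
  qed
  have near: "\<exists>j\<le>K. (v, x) \<in> graph_edges ?P ^^ j" if "x \<in> vertices ?Q" for x
    using Q[OF that] walk by blast
  have "v \<in> vertices ?Q"
  proof -
    have "tight F v \<subseteq> S" using tS[of v 0] by simp
    then have "tight S v = tight F v" using SF by (auto simp: tight_def)
    then show ?thesis using v PQ by (auto simp: vertices_polyh[OF A fin] vertices_polyh[OF A finS])
  qed
  then show "?Q \<subseteq> ?P"
  proof (rule polyh_subset_of_skeleton[OF A finS _ convex_polyh[OF A]])
    show "vertices ?Q \<subseteq> ?P"
      using near vert by (auto simp: vertices_polyh[OF A fin])
    show "z \<in> ?P" if "x \<in> vertices ?Q" "z \<in> ?Q"
      "free_dirs A (tight S x \<inter> tight S z) x \<subseteq> range (\<lambda>c. c *\<^sub>R (z - x))" for x z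
      using near[OF that(1)] stay that by blast
  qed
qed

section \<open>Walks, dimension counts and passage to a facet\<close>

lemma vertex_in: "x \<in> vertices P \<Longrightarrow> x \<in> P"
  by (simp add: vertices_def extreme_point_of_def)

lemma relpow_subset:
  fixes R S :: "('b \<times> 'b) set"
  shows "R \<subseteq> S \<Longrightarrow> (x, y) \<in> R ^^ n \<Longrightarrow> (x, y) \<in> S ^^ n"
  by (induction n arbitrary: y) auto

lemma relpow_sym:
  assumes "sym R" "(x, y) \<in> R ^^ n"
  shows "(y, x) \<in> R ^^ n"
  using assms(2)
proof (induction n arbitrary: y)
  case (Suc n)
  then obtain z where "(x, z) \<in> R ^^ n" "(z, y) \<in> R" by auto
  then have "(z, x) \<in> R ^^ n" "(y, z) \<in> R" using Suc.IH assms(1) by (auto dest: symD)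
  then show ?case by (metis relpow_Suc_I2)
qed auto

lemma relpow_compose: "(x, y) \<in> R ^^ m \<Longrightarrow> (y, z) \<in> R ^^ n \<Longrightarrow> (x, z) \<in> R ^^ (m + n)"
  by (auto simp: relpow_add)

text \<open>All hyperplanes pass through \<open>x\<close>, so no intersection is empty and each
  costs at most one dimension.\<close>

lemma aff_dim_Int_hyperplanes_ge:
  assumes "finite T" "affine A" "x \<in> A" "\<And>a b. (a, b) \<in> T \<Longrightarrow> a \<bullet> x = b"
  shows "affine {y \<in> A. \<forall>(a, b) \<in> T. a \<bullet> y = b} \<and>
    aff_dim A - int (card T) \<le> aff_dim {y \<in> A. \<forall>(a, b) \<in> T. a \<bullet> y = b}"
  using assms(1,4)
proof (induction T rule: finite_induct)
  case empty
  then show ?case using assms by simp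
next
  case (insert h T)
  obtain a b where h: "h = (a, b)" by force
  define B where "B = {y \<in> A. \<forall>(a, b) \<in> T. a \<bullet> y = b}"
  have B: "affine B" "aff_dim A - int (card T) \<le> aff_dim B" "x \<in> B"
    using insert assms(3) by (auto simp: B_def)
  have eq: "{y \<in> A. \<forall>(a, b) \<in> insert h T. a \<bullet> y = b} = B \<inter> {y. a \<bullet> y = b}"
    by (auto simp: B_def h)
  have "x \<in> B \<inter> {y. a \<bullet> y = b}" using B insert.prems[of a b] h by simp
  then have "aff_dim B - 1 \<le> aff_dim (B \<inter> {y. a \<bullet> y = b})"
    by (auto simp: aff_dim_affine_Int_hyperplane[OF B(1)])
  then show ?case
    unfolding eq using B insert(1,2) by (auto intro: affine_Int affine_hyperplane)
qed

lemma card_tight_vertex: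
  assumes A: "affine A" and fin: "finite F" and x: "x \<in> vertices (polyh A F)"
  shows "aff_dim A \<le> int (card (tight F x))"
proof -
  have xP: "x \<in> polyh A F" "free_dirs A (tight F x) x \<subseteq> {0}"
    using x by (auto simp: vertices_polyh[OF A fin])
  have xA: "x \<in> A" by (rule polyh_in[OF xP(1)])
  let ?B = "{y \<in> A. \<forall>(a, b) \<in> tight F x. a \<bullet> y = b}"
  have "?B \<subseteq> {x}"
  proof
    fix y assume y: "y \<in> ?B"
    then have "y - x \<in> free_dirs A (tight F x) x"
      by (intro free_dirsI) (auto simp: inner_diff_right tight_def)
    then show "y \<in> {x}" using xP by auto
  qed
  from aff_dim_subset[OF this] have "aff_dim ?B \<le> 0" by simp
  moreover have "aff_dim A - int (card (tight F x)) \<le> aff_dim ?B"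
    using aff_dim_Int_hyperplanes_ge[OF finite_tight[OF fin] A xA, of x] by (auto simp: tight_def)
  ultimately show ?thesis by linarith
qed

text \<open>The inequality moves into the affine space as an equation, so the system loses one
  inequality while \<open>A\<close> loses one dimension (\<open>aff_dim_facet\<close>). Faces of a
  face are faces, hence walks in the facet are walks in the polyhedron.\<close>

lemma polyh_facet:
  assumes A: "affine A" and fin: "finite F" and h: "(a, b) \<in> F"
  defines "P' \<equiv> polyh (A \<inter> {x. a \<bullet> x = b}) (F - {(a, b)})"
  shows "P' face_of polyh A F"
    and "vertices P' = {x \<in> vertices (polyh A F). a \<bullet> x = b}"
    and "graph_edges P' \<subseteq> graph_edges (polyh A F)"
proof -
  have eq: "P' = polyh A F \<inter> {x. a \<bullet> x = b}"
    using h by (auto simp: P'_def polyh_def)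
  show face: "P' face_of polyh A F"
    unfolding eq using h
    by (intro face_of_Int_supporting_hyperplane_le convex_polyh A) (auto simp: polyh_def)
  show v: "vertices P' = {x \<in> vertices (polyh A F). a \<bullet> x = b}"
    using extreme_point_of_face[OF face]
    by (auto simp: vertices_def eq extreme_point_of_def)
  show "graph_edges P' \<subseteq> graph_edges (polyh A F)"
    using v face_of_trans[OF _ face] by (auto simp: graph_edges_def edge_of_def)
qed

lemma aff_dim_facet:
  assumes "affine A" "x \<in> A" "a \<bullet> x = b" "\<not> A \<subseteq> {x. a \<bullet> x = b}"
  shows "aff_dim (A \<inter> {x. a \<bullet> x = b}) = aff_dim A - 1"
  using assms by (auto simp: aff_dim_affine_Int_hyperplane)

text \<open>The discarded inequalities are equalities on all of \<open>A\<close>. Without them,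
  every remaining hyperplane that meets \<open>A\<close> lowers its dimension by exactly one, as
  both inductions on the dimension require.\<close>

lemma polyh_nontrivial:
  "polyh A {(a, b) \<in> F. \<not> A \<subseteq> {x. a \<bullet> x = b}} = polyh A F"
  by (fastforce simp: polyh_def)

lemma line_vertices:
  assumes A: "affine A" "aff_dim A = 1" and fin: "finite F"
    and u: "u \<in> vertices (polyh A F)" and v: "v \<in> vertices (polyh A F)" and "u \<noteq> v"
  shows "(u, v) \<in> graph_edges (polyh A F)" and "x \<in> A \<Longrightarrow> \<exists>c. x - u = c *\<^sub>R (v - u)"
proof -
  have uv: "u \<in> A" "v \<in> A"
    using u v vertex_in polyh_in by blast+
  have "affine hull {u, v} = A"
    using uv \<open>u \<noteq> v\<close> A
    by (intro affine_dim_equal) (auto simp: aff_dim_affine_hull aff_dim_2 hull_minimal)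
  then show *: "\<exists>c. x - u = c *\<^sub>R (v - u)" if "x \<in> A" for x
  proof -
    have "x \<in> affine hull {u, v}" using that \<open>affine hull {u, v} = A\<close> by simp
    then obtain s t where st: "x = s *\<^sub>R u + t *\<^sub>R v" "s + t = 1"
      by (auto simp: affine_hull_2)
    have s: "s = 1 - t" using st(2) by simp
    have "x - u = t *\<^sub>R (v - u)" unfolding st(1) s by (simp add: algebra_simps)
    then show ?thesis by blast
  qed
  show "(u, v) \<in> graph_edges (polyh A F)"
    unfolding edge_polyh[OF A(1) fin]
  proof (intro conjI u v \<open>u \<noteq> v\<close> subsetI)
    fix w assume "w \<in> free_dirs A (tight F u \<inter> tight F v) u"
    then show "w \<in> range (\<lambda>c. c *\<^sub>R (v - u))"
      using *[of "u + w"] by (auto simp: free_dirs_def)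
  qed
qed

section \<open>The Kalai--Kleitman recursion\<close>

text \<open>For \<open>n < 2 * d\<close> any two vertices share a tight inequality, so one facet
  suffices. Otherwise \<open>n \<ge> 4\<close>, so halving \<open>n\<close> terminates.\<close>

fun kk_bound :: "nat \<Rightarrow> nat \<Rightarrow> nat" where
  "kk_bound d n = (if d = 0 then 0 else if d = 1 then (if n \<le> 1 then 0 else 1)
     else if n < 2 * d then kk_bound (d - 1) (n - 1)
     else kk_bound (d - 1) (n - 1) + 2 * kk_bound d (n div 2) + 2)"

declare kk_bound.simps [simp del]

text \<open>Stating this with \<open>card F \<le> n\<close> lets the induction hypothesis apply to
  every system with at most \<open>n - 1\<close> or \<open>n div 2\<close> inequalities, without an
  appeal to monotonicity of \<open>kk_bound\<close>.\<close>

theorem kalai_kleitman: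
  fixes A :: "'a::euclidean_space set"
  assumes "affine A" "aff_dim A = int d" "finite F" "card F \<le> n"
    and "u \<in> vertices (polyh A F)" "v \<in> vertices (polyh A F)"
  shows "\<exists>j\<le>kk_bound d n. (u, v) \<in> graph_edges (polyh A F) ^^ j"
  using assms
proof (induction d n arbitrary: A F u v rule: kk_bound.induct)
  case (1 d n A F0 u v)
  note A = \<open>affine A\<close> \<open>aff_dim A = int d\<close>
  define F where "F = {(a, b) \<in> F0. \<not> A \<subseteq> {x. a \<bullet> x = b}}"
  have "F \<subseteq> F0" by (auto simp: F_def)
  have fin: "finite F" and card: "card F \<le> n"
    using finite_subset[OF \<open>F \<subseteq> F0\<close>] card_mono[OF _ \<open>F \<subseteq> F0\<close>] "1.prems" by auto
  have eq: "polyh A F0 = polyh A F" by (simp add: F_def polyh_nontrivial)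
  let ?P = "polyh A F" and ?E = "graph_edges (polyh A F)"
  have u: "u \<in> vertices ?P" and v: "v \<in> vertices ?P" using "1.prems" eq by auto
  have inP: "x \<in> A" if "x \<in> vertices ?P" for x
    using that vertex_in polyh_in by blast
  \<comment> \<open>The induction hypothesis enters as an assumption because the two branches of the
    recursion supply it under different guards.\<close>
  have facet: "\<exists>j\<le>kk_bound (d - 1) (n - 1). (x, y) \<in> ?E ^^ j"
    if d: "d \<ge> 2" and IH: "\<And>(A :: 'a set) F u v. affine A \<Longrightarrow> aff_dim A = int (d - 1) \<Longrightarrow> finite F \<Longrightarrow> card F \<le> n - 1 \<Longrightarrow>
        u \<in> vertices (polyh A F) \<Longrightarrow> v \<in> vertices (polyh A F) \<Longrightarrow>
        \<exists>j\<le>kk_bound (d - 1) (n - 1). (u, v) \<in> graph_edges (polyh A F) ^^ j"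
      and xy: "x \<in> vertices ?P" "y \<in> vertices ?P" and h: "h \<in> tight F x" "h \<in> tight F y" for x y h
  proof -
    obtain a b where hab: "h = (a, b)" by force
    have hF: "(a, b) \<in> F" "a \<bullet> x = b" "a \<bullet> y = b" using h by (auto simp: hab tight_iff)
    let ?A' = "A \<inter> {x. a \<bullet> x = b}" and ?F' = "F - {(a, b)}"
    have "affine ?A'" using A by (simp add: affine_Int affine_hyperplane)
    moreover have "aff_dim ?A' = int (d - 1)"
      using aff_dim_facet[OF A(1) inP[OF xy(1)] hF(2)] hF(1) A(2) d by (auto simp: F_def)
    moreover have "finite ?F'" "card ?F' \<le> n - 1" using fin card hF by auto
    moreover have "x \<in> vertices (polyh ?A' ?F')" "y \<in> vertices (polyh ?A' ?F')"
      using polyh_facet(2)[OF A(1) fin hF(1)] xy hF by auto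
    ultimately have "\<exists>j\<le>kk_bound (d - 1) (n - 1). (x, y) \<in> graph_edges (polyh ?A' ?F') ^^ j"
      by (rule IH)
    then show ?thesis
      using relpow_subset[OF polyh_facet(3)[OF A(1) fin hF(1)]] hF by blast
  qed
  have num_tight: "d \<le> card (tight F x)" if "x \<in> vertices ?P" for x
    using card_tight_vertex[OF A(1) fin that] A(2) by simp
  consider "u = v" | "u \<noteq> v" "d = 0" | "u \<noteq> v" "d = 1" | "d \<ge> 2" "n < 2 * d" | "d \<ge> 2" "n \<ge> 2 * d"
    by linarith
  then have "\<exists>j\<le>kk_bound d n. (u, v) \<in> ?E ^^ j"
  proof cases
    case 1
    then show ?thesis by (intro exI[of _ 0]) auto
  next
    case 2
    then obtain p where "A = {p}" using A by (auto simp: aff_dim_eq_0)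
    then show ?thesis using inP u v 2 by auto
  next
    case 3
    have "n \<ge> 2"
    proof (rule ccontr)
      assume "\<not> n \<ge> 2"
      then have "card F \<le> Suc 0" using card by simp
      moreover have "tight F u \<noteq> {}" "tight F v \<noteq> {}"
        using num_tight[OF u] num_tight[OF v] 3 by auto
      then obtain h h' where h: "h \<in> tight F u" and h': "h' \<in> tight F v" by blast
      ultimately have F: "F = {h}" "h' = h"
        using tight_subset[of F] fin by (auto simp: card_le_Suc0_iff_eq)
      have "v - u \<in> free_dirs A (tight F u) u"
        using inP[OF v] h h' F by (intro free_dirsI) (auto simp: tight_def inner_diff_right)
      then show False using u 3 by (auto simp: vertices_polyh[OF A(1) fin])
    qed
    then have "kk_bound d n = 1" using 3 by (simp add: kk_bound.simps)
    moreover have "(u, v) \<in> ?E" using line_vertices(1)[OF A(1) _ fin u v] A 3 by simp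
    ultimately show ?thesis by (intro exI[of _ 1]) auto
  next
    case 4
    \<comment> \<open>Both tight sets have at least \<open>d\<close> elements, while
      \<open>F\<close> has fewer than \<open>2 * d\<close>.\<close>
    have "tight F u \<inter> tight F v \<noteq> {}"
    proof
      assume "tight F u \<inter> tight F v = {}"
      then have "card (tight F u \<union> tight F v) = card (tight F u) + card (tight F v)"
        using fin by (intro card_Un_disjoint finite_tight)
      moreover have "card (tight F u \<union> tight F v) \<le> card F"
        using fin tight_subset by (intro card_mono) auto
      ultimately show False using num_tight[OF u] num_tight[OF v] card 4 by linarith
    qed
    then obtain h where "h \<in> tight F u" "h \<in> tight F v" by blast
    then have "\<exists>j\<le>kk_bound (d - 1) (n - 1). (u, v) \<in> ?E ^^ j"
      using facet[OF 4(1) "1.IH"(1) u v] 4 by auto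
    then show ?thesis using 4 by (subst kk_bound.simps) auto
  next
    case 5
    define K where "K = kk_bound d (n div 2)"
    have kk: "kk_bound d n = kk_bound (d - 1) (n - 1) + 2 * K + 2"
      using 5 unfolding K_def by (subst kk_bound.simps) auto
    define S where "S v = {h \<in> F. \<exists>j\<le>Suc K. \<exists>y. (v, y) \<in> ?E ^^ j \<and> h \<in> tight F y}" for v
    have SF: "S x \<subseteq> F" for x by (auto simp: S_def)
    \<comment> \<open>A ball touching at most half of the inequalities already determines the
      polyhedron, so the induction hypothesis for \<open>S x\<close> bounds the distance of
      \<open>u\<close> and \<open>v\<close> directly by \<open>K\<close>.\<close>
    have small: "\<exists>j\<le>kk_bound d n. (u, v) \<in> ?E ^^ j" if x: "x \<in> vertices ?P" and c: "card (S x) \<le> n div 2" for x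
    proof -
      have fS: "finite (S x)" by (rule finite_subset[OF SF fin])
      have IH: "\<exists>j\<le>K. (p, q) \<in> graph_edges (polyh A (S x)) ^^ j"
        if "p \<in> vertices (polyh A (S x))" "q \<in> vertices (polyh A (S x))" for p q
        using "1.IH"(3)[OF _ _ _ A fS c that] 5 unfolding K_def by auto
      have sub: "?P \<subseteq> polyh A (S x)" by (rule polyh_mono[OF SF])
      have "(x, x) \<in> ?E ^^ 0" by simp
      then have "tight F x \<subseteq> S x" using tight_subset[of F x] unfolding S_def by blast
      then have "tight (S x) x = tight F x" using SF by (auto simp: tight_def)
      then have "x \<in> vertices (polyh A (S x))"
        using x sub by (auto simp: vertices_polyh[OF A(1) fin] vertices_polyh[OF A(1) fS])
      then have Q: "polyh A (S x) = ?P"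
        using ball_facets_define[OF A(1) fin x, of K] IH unfolding S_def by blast
      have "\<exists>j\<le>K. (u, v) \<in> ?E ^^ j"
        using IH[of u v] u v by (simp only: Q)
      then obtain j where "j \<le> K" "(u, v) \<in> ?E ^^ j" by blast
      then show ?thesis using kk by (intro exI[of _ j]) simp
    qed
    show ?thesis
    proof (cases "card (S u) \<le> n div 2 \<or> card (S v) \<le> n div 2")
      case True
      then show ?thesis using small u v by blast
    next
      case False
      have "S u \<inter> S v \<noteq> {}"
      proof
        assume "S u \<inter> S v = {}"
        then have "card (S u \<union> S v) = card (S u) + card (S v)"
          using fin SF by (intro card_Un_disjoint) (auto intro: finite_subset)
        moreover have "card (S u \<union> S v) \<le> card F"
          using fin SF by (intro card_mono) auto
        ultimately show False using False card by linarith
      qed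
      then obtain h x y j k where h: "h \<in> tight F x" "h \<in> tight F y"
        and j: "j \<le> Suc K" "(u, x) \<in> ?E ^^ j" and k: "k \<le> Suc K" "(v, y) \<in> ?E ^^ k"
        unfolding S_def by blast
      have x: "x \<in> vertices ?P" using j u by (cases j) (auto simp: graph_edges_def)
      have y: "y \<in> vertices ?P" using k v by (cases k) (auto simp: graph_edges_def)
      obtain i where i: "i \<le> kk_bound (d - 1) (n - 1)" "(x, y) \<in> ?E ^^ i"
        using facet[OF 5(1) "1.IH"(2) x y h] 5 by auto
      \<comment> \<open>The two balls of radius \<open>K + 1\<close> contribute
        \<open>2 * K + 2\<close>, the shared facet the remaining summand.\<close>
      have "(u, v) \<in> ?E ^^ (j + i + k)"
        using relpow_compose[OF relpow_compose[OF j(2) i(2)] relpow_sym[OF sym_graph_edges k(2)]] .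
      then show ?thesis using j k i kk by (intro exI[of _ "j + i + k"]) auto
    qed
  qed
  then show ?case by (simp add: eq)
qed

corollary graph_connected:
  assumes "affine A" "finite F" "u \<in> vertices (polyh A F)" "v \<in> vertices (polyh A F)"
  shows "(u, v) \<in> (graph_edges (polyh A F))\<^sup>*"
proof -
  have "A \<noteq> {}" using assms(3) vertex_in polyh_in by blast
  then have "aff_dim A \<ge> 0" using aff_dim_negative_iff[of A] by (simp add: not_less[symmetric])
  then obtain d where "aff_dim A = int d" using nonneg_int_cases by blast
  then show ?thesis
    using kalai_kleitman[of A d F "card F" u v] assms relpow_imp_rtrancl by blast
qed

section \<open>Larman's bound\<close>

text \<open>The interval is swept greedily: from layer \<open>a\<close> one follows the set \<open>R h\<close> that reaches
  furthest before switching.  A set met by one sweep is not met by the next but one, because it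
  would have been a better choice in between; so every set is charged at most twice.\<close>

lemma greedy_interval_cover:
  fixes R :: "'h \<Rightarrow> nat set" and F :: "'h set" and c :: nat
  defines "T \<equiv> \<lambda>p q. {h \<in> F. R h \<inter> {p..q} \<noteq> {}}"
  assumes fin: "finite F"
    and interval: "\<And>h p q i. h \<in> F \<Longrightarrow> p \<in> R h \<Longrightarrow> q \<in> R h \<Longrightarrow> p \<le> i \<Longrightarrow> i \<le> q \<Longrightarrow> i \<in> R h"
    and cover: "\<And>i. a \<le> i \<Longrightarrow> i \<le> b \<Longrightarrow> \<exists>h\<in>F. i \<in> R h"
    and chunk: "\<And>h p q. h \<in> F \<Longrightarrow> p \<in> R h \<Longrightarrow> q \<in> R h \<Longrightarrow> p \<le> q \<Longrightarrow> Suc q - p \<le> c * card (T p q)"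
  shows "Suc b - a \<le> 2 * c * card (T a b)"
proof -
  define M where "M x = {q. q \<le> b \<and> (\<exists>h\<in>F. x \<in> R h \<and> q \<in> R h)}" for x
  define nxt where "nxt x = Suc (Max (M x))" for x
  have finM: "finite (M x)" for x by (rule finite_subset[of _ "{..b}"]) (auto simp: M_def)
  have finT: "finite (T p q)" for p q using fin by (simp add: T_def)
  have M: "x \<in> M x" if "a \<le> x" "x \<le> b" for x using cover[OF that] that by (auto simp: M_def)
  have nxt: "x < nxt x" "nxt x \<le> Suc b" "Max (M x) \<in> M x" if "a \<le> x" "x \<le> b" for x
  proof -
    show "Max (M x) \<in> M x" using Max_in[OF finM] M[OF that] by blast
    then show "nxt x \<le> Suc b" by (auto simp: nxt_def M_def)
    show "x < nxt x" using Max_ge[OF finM M[OF that]] by (simp add: nxt_def)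
  qed
  have sub: "T p q \<subseteq> T p' q'" if "p' \<le> p" "q \<le> q'" for p q p' q'
    using that by (fastforce simp: T_def)
  \<comment> \<open>The sum of two cardinalities is the induction invariant for the double charging:
    the sweep from \<open>x\<close> is paid by \<open>T x (Max (M x))\<close>, which together with
    the second term of the hypothesis for \<open>y\<close> still fits disjointly into
    \<open>T x b\<close>.\<close>
  have main: "Suc b - x \<le> c * (card (T x b) + card (T (nxt x) b))" if "a \<le> x" "x \<le> b" for x
    using that
  proof (induction "b - x" arbitrary: x rule: less_induct)
    case less
    note n = nxt[OF less.prems]
    from n(3) obtain h where h: "h \<in> F" "x \<in> R h" "Max (M x) \<in> R h" by (auto simp: M_def)
    have ch: "nxt x - x \<le> c * card (T x (Max (M x)))"
      using chunk[OF h] n(1) by (simp add: nxt_def)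
    show ?case
    proof (cases "nxt x = Suc b")
      case True
      then have "T x (Max (M x)) = T x b" by (simp add: nxt_def)
      then show ?thesis using ch True by (simp add: distrib_left trans_le_add1)
    next
      case False
      define y where "y = nxt x"
      have y: "a \<le> y" "y \<le> b" "b - y < b - x" using n False less.prems by (auto simp: y_def)
      have IH: "Suc b - y \<le> c * (card (T y b) + card (T (nxt y) b))"
        by (rule less.hyps) (use y in auto)
      \<comment> \<open>A common set would contain \<open>y\<close> by the interval property and
        reach past the furthest layer available from \<open>y\<close>.\<close>
      have "T x (Max (M x)) \<inter> T (nxt y) b = {}"
      proof (rule ccontr)
        assume "T x (Max (M x)) \<inter> T (nxt y) b \<noteq> {}"
        then obtain h i k where hik: "h \<in> F" "i \<in> R h" "k \<in> R h" "i \<le> Max (M x)" "nxt y \<le> k" "k \<le> b"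
          by (auto simp: T_def)
        have "i \<le> y" "y \<le> k" using hik nxt[OF y(1,2)] by (auto simp: y_def nxt_def)
        then have "y \<in> R h" using interval[OF hik(1,2,3)] by blast
        then have "k \<in> M y" using hik by (auto simp: M_def)
        then have "k < nxt y" using Max_ge[OF finM] by (simp add: nxt_def less_Suc_eq_le)
        then show False using hik by simp
      qed
      then have "card (T x (Max (M x))) + card (T (nxt y) b) = card (T x (Max (M x)) \<union> T (nxt y) b)"
        using card_Un_disjoint[OF finT finT] by simp
      also have "\<dots> \<le> card (T x b)"
      proof (rule card_mono[OF finT])
        have "Max (M x) \<le> b" using n(2) by (simp add: nxt_def)
        moreover have "x \<le> nxt y" using nxt[OF y(1,2)] n(1) by (simp add: y_def)
        ultimately show "T x (Max (M x)) \<union> T (nxt y) b \<subseteq> T x b" using sub by simp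
      qed
      finally have "c * (card (T x (Max (M x))) + card (T (nxt y) b)) \<le> c * card (T x b)"
        by (rule mult_le_mono2)
      moreover have "Suc b - x = (nxt x - x) + (Suc b - y)" using n y by (simp add: y_def)
      ultimately show ?thesis using ch IH unfolding y_def distrib_left by linarith
    qed
  qed
  show ?thesis
  proof (cases "a \<le> b")
    case True
    have "card (T (nxt a) b) \<le> card (T a b)"
      using nxt(1)[of a] True by (intro card_mono[OF finT] sub) auto
    have "Suc b - a \<le> c * (card (T a b) + card (T (nxt a) b))"
      using main[of a] True by simp
    also have "\<dots> \<le> c * (2 * card (T a b))"
      using \<open>card (T (nxt a) b) \<le> card (T a b)\<close> by (intro mult_le_mono2) simp
    also have "\<dots> = 2 * c * card (T a b)" by simp
    finally show ?thesis .
  qed simp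
qed

text \<open>A discrete intermediate value theorem: \<open>l\<close> rises by at most one per step
  and cannot jump over \<open>i\<close>.\<close>

lemma rtrancl_intermediate_value:
  fixes l :: "'b \<Rightarrow> nat"
  assumes "(x, y) \<in> E\<^sup>*" and lip: "\<And>p q. (p, q) \<in> E \<Longrightarrow> l q \<le> Suc (l p)"
    and "l x \<le> i" "i \<le> l y"
  shows "\<exists>z. (x, z) \<in> E\<^sup>* \<and> l z = i"
  using assms(1,4)
proof (induction rule: rtrancl_induct)
  case base
  then show ?case using assms(3) by (intro exI[of _ x]) auto
next
  case (step y z)
  show ?case
  proof (cases "i \<le> l y")
    case False
    then have "l z = i" using lip[OF step(2)] step.prems by simp
    then show ?thesis using rtrancl_into_rtrancl[OF step(1,2)] by blast
  qed (use step in blast)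
qed

lemma rtrancl_vertex:
  assumes "(x, y) \<in> (graph_edges P)\<^sup>*" "x \<in> vertices P"
  shows "y \<in> vertices P"
  using assms by (induction rule: rtrancl_induct) (auto simp: graph_edges_def)

text \<open>The function \<open>l\<close> is any labelling that rises by at most one along edges,
  because distances in the whole graph do not restrict to distances in a facet, whereas this
  property does. Counting only inequalities met between the two layers is what the greedy cover can
  sum up; it costs a factor 2 per dimension above 1.\<close>

theorem larman_layers:
  fixes A :: "'a::euclidean_space set" and l :: "'a \<Rightarrow> nat"
  assumes "affine A" "aff_dim A = int (Suc d)" "finite F"
    and "\<And>p q. (p, q) \<in> graph_edges (polyh A F) \<Longrightarrow> l q \<le> Suc (l p)"
    and "x \<in> vertices (polyh A F)" "y \<in> vertices (polyh A F)" "l x \<le> l y"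
  shows "Suc (l y) - l x \<le> 2 ^ d *
    card {h \<in> F. \<exists>z\<in>vertices (polyh A F). l x \<le> l z \<and> l z \<le> l y \<and> h \<in> tight F z}"
  using assms
proof (induction d arbitrary: A F x y)
  case (0 A F0 x y)
  note A = \<open>affine A\<close> \<open>aff_dim A = int (Suc 0)\<close>
  define F where "F = {(a, b) \<in> F0. \<not> A \<subseteq> {x. a \<bullet> x = b}}"
  have "F \<subseteq> F0" by (auto simp: F_def)
  have fin: "finite F" using finite_subset[OF \<open>F \<subseteq> F0\<close>] 0 by auto
  have eq: "polyh A F0 = polyh A F" by (simp add: F_def polyh_nontrivial)
  let ?P = "polyh A F"
  let ?T = "{h \<in> F0. \<exists>z\<in>vertices (polyh A F0). l x \<le> l z \<and> l z \<le> l y \<and> h \<in> tight F0 z}"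
  have finT: "finite ?T" using 0 by simp
  have x: "x \<in> vertices ?P" and y: "y \<in> vertices ?P" using 0 eq by auto
  have "tight F x \<noteq> {}" "tight F y \<noteq> {}"
    using card_tight_vertex[OF A(1) fin x] card_tight_vertex[OF A(1) fin y] A(2) by auto
  then obtain h k where h: "h \<in> tight F x" and k: "k \<in> tight F y" by blast
  have T: "h \<in> ?T" "k \<in> ?T"
    using h k x y \<open>F \<subseteq> F0\<close> \<open>l x \<le> l y\<close> by (auto simp: tight_def eq)
  show ?case
  proof (cases "l x = l y")
    case True
    have "card ?T > 0" using T finT card_gt_0_iff by blast
    then show ?thesis using True by simp
  next
    case False
    then have "x \<noteq> y" by auto
    have A1: "aff_dim A = 1" using A by simp
    have "l y \<le> Suc (l x)"
      using line_vertices(1)[OF A(1) A1 fin x y \<open>x \<noteq> y\<close>] 0(4) by (simp add: eq)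
    \<comment> \<open>An inequality tight at two points of the line would be tight on all of
      \<open>A\<close>, and such inequalities were removed from \<open>F\<close>.\<close>
    moreover have "h \<noteq> k"
    proof
      assume "h = k"
      obtain a b where hab: "h = (a, b)" by force
      have ab: "(a, b) \<in> F" "a \<bullet> x = b" "a \<bullet> y = b" using h k \<open>h = k\<close> by (auto simp: hab tight_iff)
      have "A \<subseteq> {z. a \<bullet> z = b}"
      proof
        fix z assume "z \<in> A"
        then obtain c where "z - x = c *\<^sub>R (y - x)"
          using line_vertices(2)[OF A(1) A1 fin x y \<open>x \<noteq> y\<close>] by blast
        then have "a \<bullet> (z - x) = c * (a \<bullet> y - a \<bullet> x)" by (simp add: inner_diff_right)
        then show "z \<in> {z. a \<bullet> z = b}" using ab by (simp add: inner_diff_right)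
      qed
      then show False using ab by (auto simp: F_def)
    qed
    then have "2 \<le> card ?T" using card_mono[OF finT, of "{h, k}"] T by simp
    ultimately show ?thesis by simp
  qed
next
  case (Suc d A F0 x y)
  note A = \<open>affine A\<close> \<open>aff_dim A = int (Suc (Suc d))\<close>
  define F where "F = {(a, b) \<in> F0. \<not> A \<subseteq> {x. a \<bullet> x = b}}"
  have "F \<subseteq> F0" by (auto simp: F_def)
  have fin: "finite F" using finite_subset[OF \<open>F \<subseteq> F0\<close>] Suc.prems by auto
  have eq: "polyh A F0 = polyh A F" by (simp add: F_def polyh_nontrivial)
  let ?P = "polyh A F"
  have lip: "\<And>p q. (p, q) \<in> graph_edges ?P \<Longrightarrow> l q \<le> Suc (l p)" using Suc.prems(4) by (simp add: eq)
  have x: "x \<in> vertices ?P" and y: "y \<in> vertices ?P" using Suc.prems eq by auto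
  \<comment> \<open>The layers in which the facet of \<open>h\<close> has vertices. They form an
    interval because the graph of the facet is connected.\<close>
  define R where "R h = {l z |z. z \<in> vertices ?P \<and> h \<in> tight F z}" for h
  have T: "{h \<in> F. R h \<inter> {p..q} \<noteq> {}} = {h \<in> F. \<exists>z\<in>vertices ?P. p \<le> l z \<and> l z \<le> q \<and> h \<in> tight F z}" for p q
    by (auto simp: R_def)
  have facet: "affine (A \<inter> {x. a \<bullet> x = b})" "aff_dim (A \<inter> {x. a \<bullet> x = b}) = int (Suc d)"
    "vertices (polyh (A \<inter> {x. a \<bullet> x = b}) (F - {(a, b)})) = {x \<in> vertices ?P. a \<bullet> x = b}"
    "graph_edges (polyh (A \<inter> {x. a \<bullet> x = b}) (F - {(a, b)})) \<subseteq> graph_edges ?P"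
    if z: "z \<in> vertices ?P" and h: "(a, b) \<in> tight F z" for a b z
  proof -
    have ab: "(a, b) \<in> F" "a \<bullet> z = b" using h by (auto simp: tight_iff)
    have "z \<in> A" using z vertex_in polyh_in by blast
    then show "aff_dim (A \<inter> {x. a \<bullet> x = b}) = int (Suc d)"
      using aff_dim_facet[OF A(1) _ ab(2)] ab(1) A(2) by (auto simp: F_def)
    show "affine (A \<inter> {x. a \<bullet> x = b})" using A by (simp add: affine_Int affine_hyperplane)
  qed (use polyh_facet[OF A(1) fin] h in \<open>auto simp: tight_iff\<close>)
  have "Suc (l y) - l x \<le> 2 * 2 ^ d * card {h \<in> F. R h \<inter> {l x..l y} \<noteq> {}}"
  proof (rule greedy_interval_cover[OF fin])
    fix h p q i assume h: "h \<in> F" and p: "p \<in> R h" and q: "q \<in> R h" and i: "p \<le> i" "i \<le> q"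
    obtain a b where hab: "h = (a, b)" by force
    obtain u v where u: "u \<in> vertices ?P" "h \<in> tight F u" "p = l u" and v: "v \<in> vertices ?P" "h \<in> tight F v" "q = l v"
      using p q by (auto simp: R_def)
    let ?P' = "polyh (A \<inter> {x. a \<bullet> x = b}) (F - {(a, b)})"
    note f = facet[OF u(1) u(2)[unfolded hab]]
    have uv: "u \<in> vertices ?P'" "v \<in> vertices ?P'"
      using u v f(3) by (auto simp: hab tight_iff)
    have "(u, v) \<in> (graph_edges ?P')\<^sup>*"
      using graph_connected[OF f(1) _ uv] fin by simp
    then obtain z where z: "(u, z) \<in> (graph_edges ?P')\<^sup>*" "l z = i"
      using rtrancl_intermediate_value[of u v "graph_edges ?P'" l i] lip f(4) u v i by blast
    then have "z \<in> vertices ?P'" using rtrancl_vertex uv by blast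
    then show "i \<in> R h" using z(2) f(3) h unfolding R_def hab by (auto simp: tight_iff)
  next
    fix i assume i: "l x \<le> i" "i \<le> l y"
    have "(x, y) \<in> (graph_edges ?P)\<^sup>*" by (rule graph_connected[OF A(1) fin x y])
    then obtain z where z: "(x, z) \<in> (graph_edges ?P)\<^sup>*" "l z = i"
      using rtrancl_intermediate_value[of x y "graph_edges ?P" l i] lip i by blast
    then have zv: "z \<in> vertices ?P" using rtrancl_vertex x by blast
    then have "tight F z \<noteq> {}"
      using card_tight_vertex[OF A(1) fin zv] A(2) by auto
    then show "\<exists>h\<in>F. i \<in> R h" using zv z(2) tight_subset[of F z] by (auto simp: R_def)
  next
    fix h p q assume h: "h \<in> F" and p: "p \<in> R h" and q: "q \<in> R h" and pq: "p \<le> q"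
    obtain a b where hab: "h = (a, b)" by force
    obtain u v where u: "u \<in> vertices ?P" "h \<in> tight F u" "p = l u" and v: "v \<in> vertices ?P" "h \<in> tight F v" "q = l v"
      using p q by (auto simp: R_def)
    let ?P' = "polyh (A \<inter> {x. a \<bullet> x = b}) (F - {(a, b)})"
    note f = facet[OF u(1) u(2)[unfolded hab]]
    have uv: "u \<in> vertices ?P'" "v \<in> vertices ?P'"
      using u v f(3) by (auto simp: hab tight_iff)
    \<comment> \<open>The induction hypothesis in the facet; the inequalities it counts are also met
      by \<open>?P\<close> in the layers from \<open>p\<close> to \<open>q\<close>.\<close>
    have "Suc (l v) - l u \<le> 2 ^ d * card {h \<in> F - {(a, b)}. \<exists>z\<in>vertices ?P'. l u \<le> l z \<and> l z \<le> l v \<and> h \<in> tight (F - {(a, b)}) z}"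
      using Suc.IH[OF f(1,2) _ _ uv] lip f(4) fin pq u v by blast
    also have "\<dots> \<le> 2 ^ d * card {h \<in> F. R h \<inter> {p..q} \<noteq> {}}"
      unfolding T u(3) v(3) f(3)
      by (intro mult_le_mono2 card_mono) (use fin in \<open>auto simp: tight_def\<close>)
    finally show "Suc q - p \<le> 2 ^ d * card {h \<in> F. R h \<inter> {p..q} \<noteq> {}}" using u v by simp
  qed
  also have "\<dots> \<le> 2 ^ Suc d * card {h \<in> F0. \<exists>z\<in>vertices (polyh A F0). l x \<le> l z \<and> l z \<le> l y \<and> h \<in> tight F0 z}"
    unfolding T eq power_Suc using \<open>F \<subseteq> F0\<close> Suc.prems(3)
    by (intro mult_le_mono2 card_mono) (auto simp: tight_def)
  finally show ?case .
qed

text \<open>With \<open>l\<close> the distance from \<open>u\<close>, the layers 0 to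
  \<open>l v\<close> number \<open>l v + 1\<close>, whence \<open>Suc k\<close>.\<close>

corollary larman:
  fixes A :: "'a::euclidean_space set"
  assumes A: "affine A" "aff_dim A = int (Suc d)" and fin: "finite F"
    and u: "u \<in> vertices (polyh A F)" and v: "v \<in> vertices (polyh A F)"
  obtains k where "Suc k \<le> 2 ^ d * card F" "(u, v) \<in> graph_edges (polyh A F) ^^ k"
proof -
  let ?E = "graph_edges (polyh A F)"
  define l where "l z = (LEAST k. (u, z) \<in> ?E ^^ k)" for z
  have l: "(u, z) \<in> ?E ^^ l z" if "z \<in> vertices (polyh A F)" for z
  proof -
    have "\<exists>k. (u, z) \<in> ?E ^^ k"
      using graph_connected[OF A(1) fin u that] by (simp add: rtrancl_power)
    then show ?thesis unfolding l_def by (rule LeastI_ex)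
  qed
  have lip: "l q \<le> Suc (l p)" if "(p, q) \<in> ?E" for p q
  proof -
    have "p \<in> vertices (polyh A F)" using that by (auto simp: graph_edges_def)
    from l[OF this] that have "(u, q) \<in> ?E ^^ Suc (l p)" by auto
    then show ?thesis unfolding l_def[of q] by (rule Least_le)
  qed
  have "l u = 0" unfolding l_def by (rule Least_eq_0) simp
  then have "Suc (l v) \<le> 2 ^ d *
      card {h \<in> F. \<exists>z\<in>vertices (polyh A F). l u \<le> l z \<and> l z \<le> l v \<and> h \<in> tight F z}"
    using larman_layers[of A d F l u v, OF A fin lip u v] by simp
  also have "\<dots> \<le> 2 ^ d * card F"
    using fin by (intro mult_le_mono2 card_mono) auto
  finally show ?thesis using that l[OF v] by blast
qed

section \<open>The numerical estimate\<close>

text \<open>Squaring removes the root, with 256 = 16^2; \<open>n \<ge> 4\<close> makes the radicand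
  at least 1.\<close>

lemma le_tail_bound:
  fixes n k :: nat
  assumes "n \<ge> 4" and "256 * real k ^ 2 * (3 * log 2 n - 5) \<le> real n ^ 6"
  shows "real k \<le> 1 / 16 * (real n ^ 3 / sqrt (3 * log 2 n - 5))"
proof -
  have "2 \<le> log 2 n" using le_log2_of_power[of 2 n] assms by simp
  then have pos: "3 * log 2 n - 5 > 0" by simp
  have "(16 * real k * sqrt (3 * log 2 n - 5)) ^ 2 \<le> (real n ^ 3) ^ 2"
    using assms(2) pos by (simp add: power_mult_distrib flip: power_mult)
  then have "16 * real k * sqrt (3 * log 2 n - 5) \<le> real n ^ 3"
    by (rule power2_le_imp_le) simp
  then show ?thesis using pos by (simp add: field_simps)
qed

text \<open>An integer upper bound \<open>c\<close> for the logarithm turns the estimate into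
  arithmetic in \<open>nat\<close>. The subtraction does not truncate, as
  \<open>c \<ge> 2\<close>.\<close>

lemma le_tail_bound_of_power:
  fixes n k c :: nat
  assumes "4 \<le> n" "n \<le> 2 ^ c" and k: "256 * k ^ 2 * (3 * c - 5) \<le> n ^ 6"
  shows "real k \<le> 1 / 16 * (real n ^ 3 / sqrt (3 * log 2 n - 5))"
proof (rule le_tail_bound[OF assms(1)])
  have "2 \<le> log 2 n" "log 2 n \<le> c"
    using le_log2_of_power[of 2 n] log2_of_power_le[OF assms(2)] assms(1) by auto
  then have "3 * log 2 n - 5 \<le> real (3 * c - 5)" by linarith
  then have "256 * real k ^ 2 * (3 * log 2 n - 5) \<le> 256 * real k ^ 2 * real (3 * c - 5)"
    by (intro mult_left_mono) auto
  also have "\<dots> = real (256 * k ^ 2 * (3 * c - 5))" by simp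
  also have "\<dots> \<le> real (n ^ 6)" using k by (simp only: of_nat_le_iff)
  finally show "256 * real k ^ 2 * (3 * log 2 n - 5) \<le> real n ^ 6" by simp
qed

lemma le_tail_bound_large:
  fixes n k :: nat
  assumes n: "64 \<le> n" and k: "k \<le> n ^ 2"
  shows "real k \<le> 1 / 16 * (real n ^ 3 / sqrt (3 * log 2 n - 5))"
proof (rule le_tail_bound)
  \<comment> \<open>Scaling makes log 64 = 6 exact. The crude bound log t \<le> 2(t - 1) then
    suffices, since 13 + 6(t - 1) \<le> 16 t^2 for t \<ge> 1.\<close>
  define t where "t = real n / 64"
  have t: "t \<ge> 1" "real n = 64 * t" using n by (auto simp: t_def)
  have "log 2 (real n) = 6 + log 2 t"
    using t log_of_power_eq[of 64 2 6] by (simp add: log_mult)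
  moreover have "log 2 t \<le> 2 * (t - 1)"
  proof -
    have "ln t \<le> (t - 1) * 1" using ln_le_minus_one[of t] t by simp
    also have "\<dots> \<le> (t - 1) * (2 * ln 2)"
      using t ln2_ge_two_thirds by (intro mult_left_mono) auto
    finally show ?thesis by (simp add: log_def field_simps)
  qed
  ultimately have "3 * log 2 n - 5 \<le> 13 + 6 * (t - 1)" by simp
  then have "256 * (3 * log 2 n - 5) \<le> 256 * (13 + 6 * (t - 1))" by simp
  also have "\<dots> \<le> 4096 * t ^ 2"
    using zero_le_power2[of "t - 1"] t(1) by (simp add: power2_eq_square algebra_simps)
  also have "\<dots> = real n ^ 2" by (simp add: t(2) power_mult_distrib)
  finally have l: "256 * (3 * log 2 n - 5) \<le> real n ^ 2" .
  have "256 * real k ^ 2 * (3 * log 2 n - 5) = real k ^ 2 * (256 * (3 * log 2 n - 5))" by simp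
  also have "\<dots> \<le> real k ^ 2 * real n ^ 2" by (rule mult_left_mono[OF l]) simp
  also have "\<dots> \<le> (real n ^ 2) ^ 2 * real n ^ 2"
    using k by (intro mult_right_mono power_mono) (auto simp flip: of_nat_power)
  also have "\<dots> = real n ^ 6" by (simp flip: power_mult power_add)
  finally show "256 * real k ^ 2 * (3 * log 2 n - 5) \<le> real n ^ 6" .
qed (use n in simp)

text \<open>This is \<open>\<lceil>log 2 n\<rceil>\<close> for \<open>3 \<le> n \<le> 64\<close> only.\<close>

definition clog :: "nat \<Rightarrow> nat" where
  "clog n = (if n \<le> 4 then 2 else if n \<le> 8 then 3 else if n \<le> 16 then 4 else if n \<le> 32 then 5 else 6)"

text \<open>The ranges start at \<open>2 ^ (d - 1)\<close> and stop at the least \<open>m\<close>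
  with \<open>256 * (2 ^ (d - 1)) ^ 2 * 13 \<le> m ^ 4\<close>, from which Larman's bound takes
  over.\<close>

lemma kk_bound_small:
  shows "4 \<le> n \<Longrightarrow> n < 16 \<Longrightarrow> 256 * kk_bound 3 n ^ 2 * (3 * clog n - 5) \<le> n ^ 6"
  and "8 \<le> n \<Longrightarrow> n < 22 \<Longrightarrow> 256 * kk_bound 4 n ^ 2 * (3 * clog n - 5) \<le> n ^ 6"
  and "16 \<le> n \<Longrightarrow> n < 31 \<Longrightarrow> 256 * kk_bound 5 n ^ 2 * (3 * clog n - 5) \<le> n ^ 6"
  and "32 \<le> n \<Longrightarrow> n < 43 \<Longrightarrow> 256 * kk_bound 6 n ^ 2 * (3 * clog n - 5) \<le> n ^ 6"
proof -
  have *: "\<forall>n\<in>set [4..<16]. 256 * kk_bound 3 n ^ 2 * (3 * clog n - 5) \<le> n ^ 6"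
    "\<forall>n\<in>set [8..<22]. 256 * kk_bound 4 n ^ 2 * (3 * clog n - 5) \<le> n ^ 6"
    "\<forall>n\<in>set [16..<31]. 256 * kk_bound 5 n ^ 2 * (3 * clog n - 5) \<le> n ^ 6"
    "\<forall>n\<in>set [32..<43]. 256 * kk_bound 6 n ^ 2 * (3 * clog n - 5) \<le> n ^ 6"
    by (simp_all add: upt_rec clog_def kk_bound.simps del: One_nat_def)
  show "256 * kk_bound 3 n ^ 2 * (3 * clog n - 5) \<le> n ^ 6" if "4 \<le> n" "n < 16"
    using *(1) that unfolding set_upt by fastforce
  show "256 * kk_bound 4 n ^ 2 * (3 * clog n - 5) \<le> n ^ 6" if "8 \<le> n" "n < 22"
    using *(2) that unfolding set_upt by fastforce
  show "256 * kk_bound 5 n ^ 2 * (3 * clog n - 5) \<le> n ^ 6" if "16 \<le> n" "n < 31"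
    using *(3) that unfolding set_upt by fastforce
  show "256 * kk_bound 6 n ^ 2 * (3 * clog n - 5) \<le> n ^ 6" if "32 \<le> n" "n < 43"
    using *(4) that unfolding set_upt by fastforce
qed

lemma diameter_arith:
  fixes d n k :: nat
  assumes d: "d \<ge> 3" "2 ^ (d - 1) \<le> n"
    and k: "k \<le> kk_bound d n" "k \<le> 2 ^ (d - 1) * n"
  shows "real k \<le> 1 / 16 * (real n ^ 3 / sqrt (3 * log 2 n - 5))"
proof (cases "64 \<le> n")
  case True
  have "2 ^ (d - 1) * n \<le> n ^ 2" using d(2) by (simp add: power2_eq_square)
  then show ?thesis using le_tail_bound_large[OF True] k(2) by simp
next
  case False
  have "(2::nat) ^ (d - 1) < 2 ^ 6" using d False by simp
  then have "d - 1 < 6" by (rule power_less_imp_less_exp[rotated]) simp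
  then consider "d = 3" | "d = 4" | "d = 5" | "d = 6" using d(1) by linarith
  note d_cases = this
  have "(2::nat) ^ 2 \<le> 2 ^ (d - 1)" using d by (intro power_increasing) auto
  then have n4: "4 \<le> n" using d by simp
  have kk: ?thesis if "256 * kk_bound d n ^ 2 * (3 * clog n - 5) \<le> n ^ 6"
  proof (rule le_tail_bound_of_power[OF n4])
    show "n \<le> 2 ^ clog n" using False by (simp add: clog_def)
    have "256 * k ^ 2 * (3 * clog n - 5) \<le> 256 * kk_bound d n ^ 2 * (3 * clog n - 5)"
      using k(1) by (intro mult_le_mono power_mono) auto
    then show "256 * k ^ 2 * (3 * clog n - 5) \<le> n ^ 6" using that by (rule order_trans)
  qed
  \<comment> \<open>As \<open>n < 64\<close>, the logarithm is at most 6 and 13 = 3 * 6 - 5.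
    Cancelling the factor \<open>n ^ 2\<close> of the squared Larman bound leaves a fourth
    power.\<close>
  have larman: ?thesis if "256 * (2 ^ (d - 1)) ^ 2 * 13 \<le> m ^ 4" "m \<le> n" for m
  proof (rule le_tail_bound_of_power[OF n4])
    show "n \<le> 2 ^ 6" using False by simp
    have "256 * k ^ 2 * (3 * 6 - 5) \<le> 256 * (2 ^ (d - 1) * n) ^ 2 * 13"
      using k(2) by (intro mult_le_mono power_mono) auto
    also have "\<dots> = (256 * (2 ^ (d - 1)) ^ 2 * 13) * n ^ 2" by (simp add: power_mult_distrib)
    also have "\<dots> \<le> n ^ 4 * n ^ 2"
      using order_trans[OF that(1) power_mono[OF that(2)]] by (intro mult_le_mono) simp_all
    also have "\<dots> = n ^ 6" by (simp flip: power_add)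
    finally show "256 * k ^ 2 * (3 * 6 - 5) \<le> n ^ 6" .
  qed
  from d_cases show ?thesis
  proof cases
    case 1
    then have "4 \<le> n" using d by simp
    show ?thesis
    proof (cases "n < 16")
      case True
      show ?thesis by (rule kk) (use kk_bound_small(1)[OF \<open>4 \<le> n\<close> True] \<open>d = 3\<close> in simp)
    next
      case False
      then show ?thesis using \<open>d = 3\<close> by (intro larman[of 16]) auto
    qed
  next
    case 2
    then have "8 \<le> n" using d by simp
    show ?thesis
    proof (cases "n < 22")
      case True
      show ?thesis by (rule kk) (use kk_bound_small(2)[OF \<open>8 \<le> n\<close> True] \<open>d = 4\<close> in simp)
    next
      case False
      then show ?thesis using \<open>d = 4\<close> by (intro larman[of 22]) auto
    qed
  next
    case 3
    then have "16 \<le> n" using d by simp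
    show ?thesis
    proof (cases "n < 31")
      case True
      show ?thesis by (rule kk) (use kk_bound_small(3)[OF \<open>16 \<le> n\<close> True] \<open>d = 5\<close> in simp)
    next
      case False
      then show ?thesis using \<open>d = 5\<close> by (intro larman[of 31]) auto
    qed
  next
    case 4
    then have "32 \<le> n" using d by simp
    show ?thesis
    proof (cases "n < 43")
      case True
      show ?thesis by (rule kk) (use kk_bound_small(4)[OF \<open>32 \<le> n\<close> True] \<open>d = 6\<close> in simp)
    next
      case False
      then show ?thesis using \<open>d = 6\<close> by (intro larman[of 43]) auto
    qed
  qed
qed

theorem theorem7p1:
  fixes d n :: nat
  assumes "d \<ge> 3" and "n \<ge> 2 ^ (d - 1)"
  shows "ereal_of_enat (Delta_u TYPE('a::euclidean_space) d n)
           \<le> ereal (1 / 16 * (real n ^ 3 / sqrt (3 * log 2 (real n) - 5)))"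
proof -
  define B where "B = 1 / 16 * (real n ^ 3 / sqrt (3 * log 2 (real n) - 5))"
  \<comment> \<open>Rounding down loses nothing for integer distances and provides an element of
    \<open>enat\<close> that bounds the supremum.\<close>
  define N where "N = nat \<lfloor>B\<rfloor>"
  have "B \<ge> 0" using diameter_arith[of d n 0] assms by (simp add: B_def)
  have "edge_distance P u v \<le> enat N"
    if P: "polyhedron P" "aff_dim P = int d" "num_facets P = n" and uv: "u \<in> vertices P" "v \<in> vertices P"
    for P :: "'a set" and u v
  proof -
    have "P \<noteq> {}" using vertex_in[OF uv(1)] by auto
    then obtain F where F: "finite F" "card F \<le> n" "P = polyh (affine hull P) F"
      using polyhedron_eq_polyh[OF P(1)] P(3) by metis
    have uv': "u \<in> vertices (polyh (affine hull P) F)" "v \<in> vertices (polyh (affine hull P) F)"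
      using uv F(3) by auto
    have dim: "aff_dim (affine hull P) = int d" using P(2) by (simp add: aff_dim_affine_hull)
    have E: "graph_edges (polyh (affine hull P) F) = graph_edges P" using F(3) by simp
    obtain j where j: "j \<le> kk_bound d n" "(u, v) \<in> graph_edges P ^^ j"
      using kalai_kleitman[OF affine_affine_hull dim F(1,2) uv'] unfolding E by blast
    have "aff_dim (affine hull P) = int (Suc (d - 1))" using dim assms(1) by simp
    then obtain i where i: "Suc i \<le> 2 ^ (d - 1) * card F" "(u, v) \<in> graph_edges P ^^ i"
      using larman[OF affine_affine_hull _ F(1) uv'] unfolding E by blast
    \<comment> \<open>Both are lengths of walks from \<open>u\<close> to \<open>v\<close>, so the
      shorter one obeys both bounds at once.\<close>
    define k where "k = min i j"
    have "2 ^ (d - 1) * card F \<le> 2 ^ (d - 1) * n" using F(2) by simp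
    then have "k \<le> kk_bound d n" "k \<le> 2 ^ (d - 1) * n"
      using i(1) j(1) unfolding k_def by linarith+
    then have "real k \<le> B" unfolding B_def by (rule diameter_arith[OF assms])
    then have "k \<le> N" unfolding N_def by linarith
    moreover have "(u, v) \<in> graph_edges P ^^ k" using i j by (simp add: k_def min_def)
    then have "edge_distance P u v \<le> enat k"
      unfolding edge_distance_def by (intro INF_lower) simp
    ultimately show ?thesis by (meson enat_ord_simps(1) order_trans)
  qed
  then have "Delta_u TYPE('a) d n \<le> enat N"
    unfolding Delta_u_def graph_diameter_def by (intro SUP_least) auto
  then have "ereal_of_enat (Delta_u TYPE('a) d n) \<le> ereal_of_enat (enat N)"
    by (simp only: ereal_of_enat_le_iff)
  also have "\<dots> \<le> ereal B" using \<open>B \<ge> 0\<close> by (simp add: N_def)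
  finally show ?thesis unfolding B_def .
qed

end
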